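(* Let $K$ be an imaginary quadratic field of class number $1$ and $E/K$ an elliptic curve of odd prime power conductor with a $K$-rational point of order $7$. Then $K=\mathbb{Q}(\sqrt{-3})$ and $E$ is isomorphic to $y^2+ay=x^3+(a-2)x^2+(1-a)x$, where $a=\frac{1+\sqrt{-3}}{2}$.
   Context: An ideal is odd if it is coprime to $2$.
   Formalization: In a=(1+√−3)/2, √−3 may be either square root of −3 (depending on E): with a fixed root the claim fails, since the Galois-conjugate curve meets all hypotheses but has conductor at the other prime above 7 and so is not K-isomorphic to the given one. *)

theory Defs
  imports Complex_Main "HOL-Computational_Algebra.Computational_Algebra"
    "HOL-Algebra.Algebra" "HOL-Algebra.Algebraic_Closure_Type"
begin

section \<open>Fields and ideals inside the complex numbers\<close>

abbreviation complex_field :: "complex ring" where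
  "complex_field \<equiv> ring_of_type_algebra"

definition imaginary_quadratic_field :: "complex set \<Rightarrow> bool" where
  "imaginary_quadratic_field K \<longleftrightarrow>
     subfield K complex_field \<and> ring.dimension complex_field 2 \<rat> K \<and> \<not> K \<subseteq> \<real>"

definition ring_of_integers :: "complex set \<Rightarrow> complex ring" where
  "ring_of_integers K = complex_field\<lparr>carrier := {x \<in> K. algebraic_int x}\<rparr>"

definition nonzero_ideals :: "complex set \<Rightarrow> complex set set" where
  "nonzero_ideals K = {I. ideal I (ring_of_integers K) \<and> I \<noteq> {0}}"

definition nonzero_primes :: "complex set \<Rightarrow> complex set set" where
  "nonzero_primes K = {p. primeideal p (ring_of_integers K) \<and> p \<noteq> {0}}"

definition ideal_equivalence :: "complex set \<Rightarrow> (complex set \<times> complex set) set" where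
  "ideal_equivalence K = {(I, J). I \<in> nonzero_ideals K \<and> J \<in> nonzero_ideals K \<and>
     (\<exists>\<alpha> \<in> carrier (ring_of_integers K) - {0}. \<exists>\<beta> \<in> carrier (ring_of_integers K) - {0}.
        (\<lambda>x. \<alpha> * x) ` I = (\<lambda>x. \<beta> * x) ` J)}"

definition class_number :: "complex set \<Rightarrow> nat" where
  "class_number K = card (nonzero_ideals K // ideal_equivalence K)"

text \<open>In \<open>ideals_set R\<close> multiplication is the product of ideals, so the power below is the usual
  power of an ideal.\<close>

definition prime_power_ideal :: "complex set \<Rightarrow> complex set \<Rightarrow> bool" where
  "prime_power_ideal K I \<longleftrightarrow>
     (\<exists>p \<in> nonzero_primes K. \<exists>n::nat. n \<ge> 1 \<and> I = p [^]\<^bsub>ideals_set (ring_of_integers K)\<^esub> n)"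

definition odd_ideal :: "complex set \<Rightarrow> complex set \<Rightarrow> bool" where
  "odd_ideal K I \<longleftrightarrow>
     I <+>\<^bsub>ring_of_integers K\<^esub> (PIdl\<^bsub>ring_of_integers K\<^esub> 2) = carrier (ring_of_integers K)"

text \<open>The localisation of the ring of integers at \<open>p\<close> and its maximal ideal.\<close>

definition localization_at :: "complex set \<Rightarrow> complex set \<Rightarrow> complex set" where
  "localization_at K p =
     {x / y |x y. x \<in> carrier (ring_of_integers K) \<and> y \<in> carrier (ring_of_integers K) - p}"

definition localized_prime :: "complex set \<Rightarrow> complex set \<Rightarrow> complex set" where
  "localized_prime K p = {x / y |x y. x \<in> p \<and> y \<in> carrier (ring_of_integers K) - p}"


section \<open>Elliptic curves\<close>

text \<open>\<open>Weierstrass a1 a2 a3 a4 a6\<close> stands for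
  \<open>y^2 + a1 x y + a3 y = x^3 + a2 x^2 + a4 x + a6\<close>.\<close>

datatype 'a weierstrass =
  Weierstrass (wa1: 'a) (wa2: 'a) (wa3: 'a) (wa4: 'a) (wa6: 'a)

definition b2 :: "'a::field weierstrass \<Rightarrow> 'a" where
  "b2 E = (wa1 E)^2 + 4 * wa2 E"

definition b4 :: "'a::field weierstrass \<Rightarrow> 'a" where
  "b4 E = 2 * wa4 E + wa1 E * wa3 E"

definition b6 :: "'a::field weierstrass \<Rightarrow> 'a" where
  "b6 E = (wa3 E)^2 + 4 * wa6 E"

definition b8 :: "'a::field weierstrass \<Rightarrow> 'a" where
  "b8 E = (wa1 E)^2 * wa6 E + 4 * wa2 E * wa6 E - wa1 E * wa3 E * wa4 E
            + wa2 E * (wa3 E)^2 - (wa4 E)^2"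

definition c4 :: "'a::field weierstrass \<Rightarrow> 'a" where
  "c4 E = (b2 E)^2 - 24 * b4 E"

definition discr :: "'a::field weierstrass \<Rightarrow> 'a" where
  "discr E = - ((b2 E)^2 * b8 E) - 8 * (b4 E)^3 - 27 * (b6 E)^2 + 9 * b2 E * b4 E * b6 E"

definition defined_over :: "'a set \<Rightarrow> 'a weierstrass \<Rightarrow> bool" where
  "defined_over A E \<longleftrightarrow> {wa1 E, wa2 E, wa3 E, wa4 E, wa6 E} \<subseteq> A"

definition elliptic_curve :: "'a::field set \<Rightarrow> 'a weierstrass \<Rightarrow> bool" where
  "elliptic_curve K E \<longleftrightarrow> defined_over K E \<and> discr E \<noteq> 0"

text \<open>The relations below between the coefficients say that substituting
  \<open>x = u^2 x' + r\<close> and \<open>y = u^3 y' + u^2 s x' + t\<close> turns the equation of \<open>E\<close> into that of \<open>E'\<close>;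
  these are the isomorphisms of Weierstrass curves preserving the point at infinity.\<close>

definition isomorphic_over :: "'a::field set \<Rightarrow> 'a weierstrass \<Rightarrow> 'a weierstrass \<Rightarrow> bool" where
  "isomorphic_over K E E' \<longleftrightarrow> (\<exists>u \<in> K. \<exists>r \<in> K. \<exists>s \<in> K. \<exists>t \<in> K. u \<noteq> 0 \<and>
     u * wa1 E' = wa1 E + 2 * s \<and>
     u^2 * wa2 E' = wa2 E - s * wa1 E + 3 * r - s^2 \<and>
     u^3 * wa3 E' = wa3 E + r * wa1 E + 2 * t \<and>
     u^4 * wa4 E' = wa4 E - s * wa3 E + 2 * r * wa2 E - (t + r * s) * wa1 E + 3 * r^2
                      - 2 * s * t \<and>
     u^6 * wa6 E' = wa6 E + r * wa4 E + r^2 * wa2 E + r^3 - t * wa3 E - t^2 - r * t * wa1 E)"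

datatype 'a point = AtInfinity | Affine 'a 'a

definition curve_points :: "'a::field set \<Rightarrow> 'a weierstrass \<Rightarrow> 'a point set" where
  "curve_points K E = insert AtInfinity {Affine x y |x y. x \<in> K \<and> y \<in> K \<and>
     y^2 + wa1 E * x * y + wa3 E * y = x^3 + wa2 E * x^2 + wa4 E * x + wa6 E}"

text \<open>Chord-tangent law; \<open>l\<close> is the slope of the line through the two points (or of the
  tangent).\<close>

fun point_add :: "'a::field weierstrass \<Rightarrow> 'a point \<Rightarrow> 'a point \<Rightarrow> 'a point" where
  "point_add E AtInfinity Q = Q"
| "point_add E P AtInfinity = P"
| "point_add E (Affine x1 y1) (Affine x2 y2) =
     (if x1 = x2 \<and> y1 + y2 + wa1 E * x2 + wa3 E = 0 then AtInfinity
      else let l = (if x1 = x2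
                    then (3 * x1^2 + 2 * wa2 E * x1 + wa4 E - wa1 E * y1)
                           / (2 * y1 + wa1 E * x1 + wa3 E)
                    else (y2 - y1) / (x2 - x1));
               x3 = l^2 + wa1 E * l - wa2 E - x1 - x2
           in Affine x3 (l * (x1 - x3) - y1 - wa1 E * x3 - wa3 E))"

definition point_group :: "'a::field set \<Rightarrow> 'a weierstrass \<Rightarrow> 'a point monoid" where
  "point_group K E = \<lparr>carrier = curve_points K E, monoid.mult = point_add E, one = AtInfinity\<rparr>"

definition has_order :: "('a, 'b) monoid_scheme \<Rightarrow> 'a \<Rightarrow> nat \<Rightarrow> bool" where
  "has_order G P n \<longleftrightarrow> P \<in> carrier G \<and> n > 0 \<and> P [^]\<^bsub>G\<^esub> n = \<one>\<^bsub>G\<^esub> \<and>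
     (\<forall>m::nat. 0 < m \<and> m < n \<longrightarrow> P [^]\<^bsub>G\<^esub> m \<noteq> \<one>\<^bsub>G\<^esub>)"


section \<open>Reduction type at a prime\<close>

text \<open>The localisation is a discrete valuation ring, so the last clause says that the valuation
  of the discriminant is minimal.\<close>

definition minimal_model_at ::
    "complex set \<Rightarrow> complex set \<Rightarrow> complex weierstrass \<Rightarrow> complex weierstrass \<Rightarrow> bool" where
  "minimal_model_at K p E M \<longleftrightarrow>
     isomorphic_over K E M \<and> defined_over (localization_at K p) M \<and>
     (\<forall>M'. isomorphic_over K E M' \<and> defined_over (localization_at K p) M' \<longrightarrow>
        discr M' / discr M \<in> localization_at K p)"

definition good_reduction :: "complex set \<Rightarrow> complex set \<Rightarrow> complex weierstrass \<Rightarrow> bool" where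
  "good_reduction K p E \<longleftrightarrow> (\<exists>M. minimal_model_at K p E M \<and> discr M \<notin> localized_prime K p)"

text \<open>The reduction of a minimal model has a node iff it is singular with nonzero \<open>c4\<close>, and a cusp
  iff it is singular with \<open>c4 = 0\<close>.\<close>

definition multiplicative_reduction ::
    "complex set \<Rightarrow> complex set \<Rightarrow> complex weierstrass \<Rightarrow> bool" where
  "multiplicative_reduction K p E \<longleftrightarrow>
     (\<exists>M. minimal_model_at K p E M \<and> discr M \<in> localized_prime K p \<and>
          c4 M \<notin> localized_prime K p)"


section \<open>The conductor\<close>

definition torsion_points :: "nat \<Rightarrow> complex weierstrass \<Rightarrow> complex point set" where
  "torsion_points n E =
     {P \<in> curve_points UNIV E. P [^]\<^bsub>point_group UNIV E\<^esub> n = AtInfinity}"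

text \<open>The field generated over \<open>K\<close> by the coordinates of the \<open>n\<close>-torsion points.\<close>

definition torsion_field :: "complex set \<Rightarrow> nat \<Rightarrow> complex weierstrass \<Rightarrow> complex set" where
  "torsion_field K n E =
     generate_field complex_field (K \<union> (\<Union>P \<in> torsion_points n E. set_point P))"

text \<open>Automorphisms are normalised outside \<open>L\<close>, so that the set below is the Galois group with
  its true cardinality.\<close>

definition galois_group :: "complex set \<Rightarrow> complex set \<Rightarrow> (complex \<Rightarrow> complex) set" where
  "galois_group K L =
     {\<sigma> \<in> ring_iso (complex_field\<lparr>carrier := L\<rparr>) (complex_field\<lparr>carrier := L\<rparr>).
        \<sigma> \<in> extensional L \<and> (\<forall>x \<in> K. \<sigma> x = x)}"

text \<open>Ramification groups in the lower numbering at a prime \<open>q\<close> of \<open>L\<close>. For \<open>i = 0\<close> this is the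
  inertia group; its elements fix \<open>q\<close>, so these are also the ramification groups of the extension
  of completions.\<close>

definition ramification_group ::
    "complex set \<Rightarrow> complex set \<Rightarrow> complex set \<Rightarrow> nat \<Rightarrow> (complex \<Rightarrow> complex) set" where
  "ramification_group K L q i =
     {\<sigma> \<in> galois_group K L. \<forall>x \<in> carrier (ring_of_integers L).
        \<sigma> x - x \<in> q [^]\<^bsub>ideals_set (ring_of_integers L)\<^esub> (i + 1)}"

text \<open>The wild part at \<open>p\<close> of the conductor exponent is
  \<open>\<delta> = (\<Sum>i\<ge>1. (g\<^sub>i / g\<^sub>0) * dim (E[\<ell>] / E[\<ell>]^G\<^sub>i))\<close>,
  where \<open>\<ell>\<close> is a prime different from the residue characteristic of \<open>p\<close>, the dimension is
  over the field with \<open>\<ell>\<close> elements, \<open>G\<^sub>i\<close> are the ramification groups of \<open>K(E[\<ell>]) / K\<close> at a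
  prime \<open>q\<close> above \<open>p\<close>, and \<open>g\<^sub>i\<close> is the order of \<open>G\<^sub>i\<close>. The value does not depend on the choice
  of \<open>\<ell>\<close> and \<open>q\<close>. The dimension is computed as the logarithm to base \<open>\<ell>\<close> of the index.
  The sum is restricted to the finitely many \<open>i\<close> with \<open>G\<^sub>i\<close> nontrivial, the other terms being
  zero.\<close>

definition aux_prime :: "complex set \<Rightarrow> nat" where
  "aux_prime p = (LEAST l::nat. Factorial_Ring.prime l \<and> of_nat l \<notin> p)"

definition prime_above :: "complex set \<Rightarrow> complex set \<Rightarrow> complex set" where
  "prime_above L p = (SOME q. q \<in> nonzero_primes L \<and> p \<subseteq> q)"

definition wild_exponent :: "complex set \<Rightarrow> complex set \<Rightarrow> complex weierstrass \<Rightarrow> real" where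
  "wild_exponent K p E =
     (let l = aux_prime p;
          T = torsion_points l E;
          L = torsion_field K l E;
          G = ramification_group K L (prime_above L p)
      in \<Sum>i | i \<ge> 1 \<and> card (G i) > 1.
           real (card (G i)) / real (card (G 0)) *
           log (real l) (real (card T) / real (card {P \<in> T. \<forall>\<sigma> \<in> G i. map_point \<sigma> P = P})))"

text \<open>The wild part is a nonnegative integer, so rounding does not change it.\<close>

definition conductor_exponent :: "complex set \<Rightarrow> complex set \<Rightarrow> complex weierstrass \<Rightarrow> nat" where
  "conductor_exponent K p E =
     (if good_reduction K p E then 0
      else if multiplicative_reduction K p E then 1
      else 2 + nat \<lfloor>wild_exponent K p E\<rfloor>)"

text \<open>The product runs over the finitely many primes with nonzero exponent, since \<open>finprod\<close> over an
  infinite index set is trivial.\<close>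

definition conductor :: "complex set \<Rightarrow> complex weierstrass \<Rightarrow> complex set" where
  "conductor K E =
     (\<Otimes>\<^bsub>ideals_set (ring_of_integers K)\<^esub>p \<in> {p \<in> nonzero_primes K. conductor_exponent K p E > 0}.
        p [^]\<^bsub>ideals_set (ring_of_integers K)\<^esub> conductor_exponent K p E)"

end

theory Submission
  imports Defs
begin

text \<open>Over \<open>K\<close> the curve has a Tate normal form with one parameter \<open>d\<close>, and its \<open>j\<close>-invariant is
  \<open>c4_form a b ^ 3 / discr_form a b\<close> where \<open>d = a / b\<close> in lowest terms. Every prime dividing
  \<open>a b (a - b)\<close> occurs in the denominator of the \<open>j\<close>-invariant, hence is a prime of bad reduction and
  divides the conductor. As \<open>a\<close>, \<open>b\<close>, \<open>a - b\<close> are pairwise coprime and only one prime divides the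
  conductor, two of them are units. After the substitution \<open>(a, b) \<mapsto> (a - b, a)\<close> of order three,
  which fixes the \<open>j\<close>-invariant, the parameter is a unit \<open>e \<noteq> 1\<close> of an imaginary quadratic field,
  so it is a root of unity of order 2, 3, 4 or 6. Orders 2 and 4 give bad reduction above 2, order 3
  gives bad reduction above both 3 and 139, and the primitive sixth roots of unity are the fixed
  points of the substitution.\<close>

section \<open>Imaginary quadratic fields\<close>

text \<open>The parameter \<open>d\<close> is a coordinate on the modular curve X_1(7), and 0, 1 and
  infinity are three of its six cusps, where the j-invariant has a pole of order 7. The substitution
  is \<open>d \<mapsto> 1 - 1 / d\<close>. It comes from replacing the marked point by one of its
  multiples, an action of the group of order three of units modulo 7 up to sign, and it permutes
  these three cusps. At a fixed point the curve has an automorphism carrying the point of order 7 to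
  another multiple, so the j-invariant is 0 there.

  The obstacle is the conductor: its exponents rest on minimal models and ramification groups. None
  of these is computed. An integral model with unit discriminant has integral j-invariant, so a pole
  of the j-invariant at a prime already excludes good reduction, and a positive exponent is all that
  is then required of the conductor.

  Class number one makes the ring of integers principal. This supplies numerators and denominators
  with a Bezout relation, a prime ideal through each nonzero non-unit, and the maximality of nonzero
  primes.\<close>

interpretation complex_field: domain complex_field
  using field_from_type_algebra by (rule field.axioms)

lemma complex_field_simps [simp]:
  "carrier complex_field = UNIV" "monoid.mult complex_field = (*)" "ring.add complex_field = (+)"
  "monoid.one complex_field = 1" "ring.zero complex_field = 0"
  by (simp_all add: ring_of_type_algebra_def)

lemma complex_field_a_inv [simp]: "a_inv complex_field x = - x"
  by (rule complex_field.minus_equality) auto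

lemma complex_field_m_inv [simp]: "x \<noteq> 0 \<Longrightarrow> m_inv complex_field x = inverse x"
  by (rule complex_field.comm_inv_char) auto

lemma subfield_complexE:
  assumes "subfield K complex_field"
  shows "0 \<in> K" "1 \<in> K" "\<And>x y. x \<in> K \<Longrightarrow> y \<in> K \<Longrightarrow> x + y \<in> K"
    "\<And>x y. x \<in> K \<Longrightarrow> y \<in> K \<Longrightarrow> x * y \<in> K" "\<And>x. x \<in> K \<Longrightarrow> - x \<in> K"
    "\<And>x. x \<in> K \<Longrightarrow> inverse x \<in> K"
proof -
  show "0 \<in> K" "1 \<in> K" "\<And>x y. x \<in> K \<Longrightarrow> y \<in> K \<Longrightarrow> x + y \<in> K"
    "\<And>x y. x \<in> K \<Longrightarrow> y \<in> K \<Longrightarrow> x * y \<in> K" "\<And>x. x \<in> K \<Longrightarrow> - x \<in> K"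
    using subringE[OF subfieldE(1)[OF assms]] by auto
  then show "inverse x \<in> K" if "x \<in> K" for x
    using complex_field.subfield_m_inv[OF assms, of x] that by (cases "x = 0") auto
qed

locale complex_subfield =
  fixes K :: "complex set"
  assumes subfield: "subfield K complex_field"
begin

lemmas closed [intro, simp] = subfield_complexE[OF subfield]

lemma diff_closed [intro, simp]: "x \<in> K \<Longrightarrow> y \<in> K \<Longrightarrow> x - y \<in> K"
  using closed(3)[of x "- y"] by simp

lemma divide_closed [intro, simp]: "x \<in> K \<Longrightarrow> y \<in> K \<Longrightarrow> x / y \<in> K"
  by (simp add: divide_inverse)

lemma power_closed [intro, simp]: "x \<in> K \<Longrightarrow> x ^ n \<in> K"
  by (induction n) auto

lemma of_nat_closed [intro, simp]: "of_nat n \<in> K"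
  by (induction n) auto

lemma numeral_closed [intro, simp]: "numeral n \<in> K"
  by (metis of_nat_closed of_nat_numeral)

lemma of_int_closed [intro, simp]: "of_int n \<in> K"
  by (cases n) auto

lemma Rats_subset: "\<rat> \<subseteq> K"
  by (auto elim!: Rats_cases')

lemma Rats_closed [intro, simp]: "x \<in> \<rat> \<Longrightarrow> x \<in> K"
  using Rats_subset by blast

end

text \<open>The imaginary parts determine the trace, because \<open>Im x\<close> can be cancelled;
  the quadratic equation then determines the norm.\<close>

lemma root_of_real_quadratic:
  fixes t n :: real and x :: complex
  assumes "x\<^sup>2 = t * x - n" "x \<notin> \<real>"
  shows "x + cnj x = t" "x * cnj x = n"
proof -
  have "Im (x\<^sup>2) = t * Im x" using assms(1) by simp
  then have "2 * Re x * Im x = t * Im x" by (simp add: power2_eq_square)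
  moreover have "Im x \<noteq> 0" using assms(2) by (simp add: complex_is_Real_iff)
  ultimately have "2 * Re x = t" by simp
  then show *: "x + cnj x = t" by (simp add: complex_add_cnj)
  then have "cnj x = t - x" by (simp add: algebra_simps)
  then have "x * cnj x = t * x - x\<^sup>2"
    by (simp flip: * add: algebra_simps power2_eq_square)
  then show "x * cnj x = n" using assms(1) by simp
qed

section \<open>Rational bases, conjugation, trace and norm\<close>

locale imaginary_quadratic =
  fixes K :: "complex set"
  assumes imag_quad: "imaginary_quadratic_field K"

sublocale imaginary_quadratic \<subseteq> complex_subfield
  using imag_quad by (simp add: complex_subfield_def imaginary_quadratic_field_def)

context imaginary_quadratic
begin

text \<open>\<open>dimension\<close> is inductive, with one \<open>line_extension\<close> for each
  basis vector; two case distinctions peel off two vectors and a third leaves the zero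
  space.\<close>

lemma spanned_by_two:
  obtains v1 v2 where "K = {a * v1 + b * v2 |a b. a \<in> \<rat> \<and> b \<in> \<rat>}"
proof -
  have ext: "complex_field.line_extension \<rat> v E = {a * v + e |a e. a \<in> \<rat> \<and> e \<in> E}" for v E
    by (auto simp: complex_field.line_extension_def set_add_def set_mult_def r_coset_def)
  have "complex_field.dimension (Suc (Suc 0)) \<rat> K"
    using imag_quad by (simp add: imaginary_quadratic_field_def numeral_2_eq_2)
  then obtain v1 E1 where 1: "complex_field.dimension (Suc 0) \<rat> E1"
      "K = complex_field.line_extension \<rat> v1 E1"
    by (cases rule: complex_field.dimension.cases) auto
  from 1(1) obtain v2 E0 where "complex_field.dimension 0 \<rat> E0"
      "E1 = complex_field.line_extension \<rat> v2 E0"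
    by (cases rule: complex_field.dimension.cases) auto
  moreover from this(1) have "E0 = {0}"
    by (cases rule: complex_field.dimension.cases) auto
  ultimately have "E1 = complex_field.line_extension \<rat> v2 {0}" by simp
  then have "K = {a * v1 + b * v2 |a b. a \<in> \<rat> \<and> b \<in> \<rat>}"
    using 1(2) unfolding ext by auto
  then show thesis by (rule that)
qed

text \<open>Cramer's rule, applied to the coordinates of 1, \<open>x\<close> and \<open>y\<close>
  with respect to two spanning vectors.\<close>

lemma spanned_by_one_and:
  assumes "x \<in> K" "x \<notin> \<rat>" "y \<in> K"
  obtains a b where "a \<in> \<rat>" "b \<in> \<rat>" "y = a + b * x"
proof -
  obtain v1 v2 where span: "K = {a * v1 + b * v2 |a b. a \<in> \<rat> \<and> b \<in> \<rat>}"
    by (rule spanned_by_two)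
  have "\<exists>a b. a \<in> \<rat> \<and> b \<in> \<rat> \<and> z = a * v1 + b * v2" if "z \<in> K" for z
    using span that by auto
  then obtain a b c d e f where rat: "a \<in> \<rat>" "b \<in> \<rat>" "c \<in> \<rat>" "d \<in> \<rat>" "e \<in> \<rat>" "f \<in> \<rat>"
    and eqs: "1 = a * v1 + b * v2" "x = c * v1 + d * v2" "y = e * v1 + f * v2"
    using assms closed(2) by meson
  \<comment> \<open>A vanishing determinant would make 1 and \<open>x\<close> proportional over the
    rationals, so \<open>x\<close> would be rational.\<close>
  have det: "a * d - b * c \<noteq> 0"
  proof
    assume 0: "a * d - b * c = 0"
    show False
    proof (cases "a = 0")
      case True
      then have "b \<noteq> 0" "c = 0" using 0 eqs by auto
      then have "x = d / b" using True eqs by (simp add: field_simps)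
      then show False using assms rat by auto
    next
      case False
      have "a * x = c * (a * v1 + b * v2) + (a * d - b * c) * v2"
        unfolding eqs(2) by (simp add: algebra_simps)
      then have "a * x = c" using 0 by (simp flip: eqs(1))
      then have "x = c / a" using False by (simp add: field_simps)
      then show False using assms rat by auto
    qed
  qed
  have "(a * d - b * c) * y = (e * d - f * c) * (a * v1 + b * v2) + (a * f - b * e) * x"
    unfolding eqs(2,3) by (simp add: algebra_simps)
  then have "(a * d - b * c) * y = (e * d - f * c) + (a * f - b * e) * x"
    by (simp flip: eqs(1))
  then have "y * (a * d - b * c) = (e * d - f * c) + (a * f - b * e) * x"
    by (simp only: mult.commute)
  then have "y = ((e * d - f * c) + (a * f - b * e) * x) / (a * d - b * c)"
    by (rule eq_divide_imp[OF det])
  then have "y = (e * d - f * c) / (a * d - b * c) + (a * f - b * e) / (a * d - b * c) * x"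
    by (simp add: add_divide_distrib)
  then show thesis by (rule that[rotated 2]) (use rat in auto)
qed

lemma Rats_real: "z \<in> \<rat> \<Longrightarrow> \<exists>r. z = complex_of_real r"
  by (elim Rats_cases') (metis of_real_divide of_real_of_int_eq)

text \<open>Together with 1, a real irrational \<open>x\<close> would span \<open>K\<close> over the
  rationals and force \<open>K\<close> into the reals.\<close>

lemma real_imp_Rats:
  assumes "x \<in> K" "x \<in> \<real>"
  shows "x \<in> \<rat>"
proof (rule ccontr)
  assume "x \<notin> \<rat>"
  obtain y where y: "y \<in> K" "y \<notin> \<real>"
    using imag_quad by (auto simp: imaginary_quadratic_field_def)
  obtain a b where "a \<in> \<rat>" "b \<in> \<rat>" "y = a + b * x"
    using spanned_by_one_and[OF assms(1) \<open>x \<notin> \<rat>\<close> y(1)] .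
  then show False using y assms Rats_real[of a] Rats_real[of b] by (metis Reals_add Reals_mult Reals_of_real)
qed

text \<open>For nonreal \<open>x\<close>, writing \<open>x^2\<close> in the basis 1,
  \<open>x\<close> gives a rational quadratic equation whose other root is \<open>cnj x\<close>.
  Closure of \<open>K\<close> under conjugation is a consequence, not an ingredient.\<close>

lemma trace_norm_Rats:
  assumes "x \<in> K"
  shows "x + cnj x \<in> \<rat>" "x * cnj x \<in> \<rat>"
proof -
  have "x + cnj x \<in> \<rat> \<and> x * cnj x \<in> \<rat>"
  proof (cases "x \<in> \<real>")
    case True
    then have "x \<in> \<rat>" using assms real_imp_Rats by blast
    moreover have "cnj x = x" using True by (simp add: Reals_cnj_iff)
    ultimately show ?thesis by simp
  next
    case False
    then have "x \<notin> \<rat>" using Rats_real by fastforce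
    then obtain a b where ab: "a \<in> \<rat>" "b \<in> \<rat>" "x\<^sup>2 = a + b * x"
      using spanned_by_one_and[of x "x\<^sup>2"] assms by blast
    then obtain r s where rs: "a = complex_of_real r" "b = complex_of_real s"
      using Rats_real by blast
    then have "x\<^sup>2 = complex_of_real s * x - complex_of_real (- r)" using ab by simp
    from root_of_real_quadratic[OF this False] show ?thesis using rs ab by simp
  qed
  then show "x + cnj x \<in> \<rat>" "x * cnj x \<in> \<rat>" by auto
qed

lemma cnj_closed [intro, simp]: "x \<in> K \<Longrightarrow> cnj x \<in> K"
  using diff_closed[OF Rats_closed[OF trace_norm_Rats(1)], of x x] by simp

end

section \<open>Integrality in terms of trace and norm\<close>

lemma map_poly_of_int_add:
  "map_poly of_int (p + q) = (map_poly of_int p + map_poly of_int q :: 'a::ring_1 poly)"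
  by (simp add: poly_eq_iff coeff_map_poly)

lemma map_poly_of_int_mult:
  "map_poly of_int (p * q) = (map_poly of_int p * map_poly of_int q :: 'a::comm_ring_1 poly)"
  by (simp add: poly_eq_iff coeff_map_poly coeff_mult)

lemma map_poly_of_int_smult:
  "map_poly of_int (smult c q) = (smult (of_int c) (map_poly of_int q) :: 'a::comm_ring_1 poly)"
  by (simp add: poly_eq_iff coeff_map_poly)

text \<open>Gauss's lemma: the integral multiple of the minimal polynomial of \<open>x\<close> with leading coefficient
  \<open>D\<close> has content \<open>D\<close>, because it divides a power of \<open>D\<close> times a monic polynomial.\<close>

lemma monic_quadratic_factor_integral:
  fixes x :: complex
  assumes "algebraic_int x" "x \<notin> \<real>" and rat: "x + cnj x \<in> \<rat>" "x * cnj x \<in> \<rat>"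
  shows "x + cnj x \<in> \<int>" "x * cnj x \<in> \<int>"
proof -
  obtain p :: "int poly" where p: "poly (map_poly of_int p) x = 0" "lead_coeff p = 1"
    using assms(1) by (auto simp: algebraic_int_altdef_ipoly)
  obtain a b where ab: "x + cnj x = of_int a / of_int b" "b > 0"
    using rat(1) by (rule Rats_cases')
  obtain c d where cd: "x * cnj x = of_int c / of_int d" "d > 0"
    using rat(2) by (rule Rats_cases')
  define D where "D = b * d"
  \<comment> \<open>The polynomial with roots \<open>x\<close> and \<open>cnj x\<close>, cleared of
    the denominators \<open>b\<close> and \<open>d\<close>.\<close>
  define Q :: "int poly" where "Q = [:c * b, - (a * d), D:]"
  have D: "D > 0" using ab cd by (simp add: D_def)
  have degQ: "degree Q = 2" "lead_coeff Q = D" "Q \<noteq> 0" using D by (auto simp: Q_def)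
  have Qx: "poly (map_poly of_int Q) x = 0"
  proof -
    have *: "of_int a = of_int b * (x + cnj x)" "of_int c = of_int d * (x * cnj x)"
      using ab cd by auto
    show ?thesis unfolding Q_def D_def
      by (simp add: map_poly_pCons *) (simp add: algebra_simps)
  qed
  \<comment> \<open>Pseudo-division, since \<open>D\<close> need not be invertible over the
    integers. The remainder has degree at most 1 and vanishes at the nonreal \<open>x\<close>, so it
    is zero.\<close>
  obtain R S where RS: "pseudo_divmod p Q = (R, S)" by fastforce
  define k where "k = Suc (degree p) - degree Q"
  have eq: "smult (D ^ k) p = Q * R + S" and S: "S = 0 \<or> degree S < 2"
    using pseudo_divmod[OF degQ(3) RS] degQ by (auto simp: k_def)
  have "S = 0"
  proof -
    have "poly (map_poly of_int (smult (D ^ k) p)) x = 0"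
      using p by (simp add: map_poly_of_int_smult)
    then have 0: "poly (map_poly of_int S) x = 0"
      unfolding eq using Qx by (simp add: map_poly_of_int_add map_poly_of_int_mult)
    obtain u v where S_eq: "S = [:u, v:]"
    proof (rule that[of "coeff S 0" "coeff S 1"])
      have "coeff S i = 0" if "i \<ge> 2" for i
        using S that by (auto intro: coeff_eq_0)
      then show "S = [:coeff S 0, coeff S 1:]"
        by (auto simp: poly_eq_iff coeff_pCons split: nat.splits)
    qed
    then have uv: "of_int u + x * of_int v = 0" using 0 by (simp add: map_poly_pCons)
    have "v = 0"
    proof (rule ccontr)
      assume "v \<noteq> 0"
      then have "x = - of_int u / of_int v" using uv by (simp add: field_simps add_eq_0_iff)
      then have "x \<in> \<real>" by auto
      then show False using assms by simp
    qed
    then show ?thesis using uv S_eq by simp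
  qed
  then have eq: "smult (D ^ k) p = Q * R" using eq by simp
  have "lead_coeff (smult (D ^ k) p) = D * lead_coeff R"
    unfolding eq lead_coeff_mult degQ(2) ..
  then have lead: "D ^ k = D * lead_coeff R" using p D by simp
  have "is_unit (content p)" using content_dvd_coeff[of p "degree p"] p by simp
  then have "content p = 1" using normalize_content[of p] is_unit_normalize[of "content p"] by simp
  then have "D ^ k = content (Q * R)" using D by (simp flip: eq)
  then have content: "D ^ k = content Q * content R" by (simp add: content_mult)
  obtain y where y: "D = content Q * y" 
    using content_dvd_coeff[of Q "degree Q"] unfolding degQ(2) by (rule dvdE)
  obtain z where z: "lead_coeff R = content R * z"
    using content_dvd_coeff by (rule dvdE)
  \<comment> \<open>\<open>y\<close> and \<open>z\<close> are the leading coefficients of the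
    primitive parts of \<open>Q\<close> and \<open>R\<close>. Multiplicativity of the content makes
    their product 1, so \<open>content Q\<close> agrees with \<open>D\<close> up to a unit.\<close>
  have "D ^ k = D ^ k * (y * z)" using lead y z content by (simp add: mult_ac)
  then have "y * z = 1" using D by simp
  then have "is_unit y" by (rule dvdI[OF sym])
  then have "D dvd content Q" using y by simp
  then have "D dvd coeff Q i" for i using content_dvd_coeff dvd_trans by blast
  from this[of 0] this[of 1] have "D dvd c * b" "D dvd a * d" by (auto simp: Q_def)
  then have "d dvd c" "b dvd a" using ab cd by (auto simp: D_def mult.commute)
  then show "x + cnj x \<in> \<int>" "x * cnj x \<in> \<int>" using ab cd by (auto elim!: dvdE)
qed

context imaginary_quadratic
begin

text \<open>Later closure and unit arguments reduce through this criterion to statements about two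
  rational integers.\<close>

lemma algebraic_int_iff:
  assumes "x \<in> K"
  shows "algebraic_int x \<longleftrightarrow> x + cnj x \<in> \<int> \<and> x * cnj x \<in> \<int>"
proof
  assume x: "algebraic_int x"
  show "x + cnj x \<in> \<int> \<and> x * cnj x \<in> \<int>"
  proof (cases "x \<in> \<real>")
    case True
    then have "x \<in> \<int>" "cnj x = x"
      using assms real_imp_Rats rational_algebraic_int_is_int x by (auto simp: Reals_cnj_iff)
    then show ?thesis by auto
  next
    case False
    then show ?thesis
      using monic_quadratic_factor_integral x trace_norm_Rats[OF assms] by blast
  qed
next
  assume *: "x + cnj x \<in> \<int> \<and> x * cnj x \<in> \<int>"
  show "algebraic_int x"
  proof (rule algebraic_int.intros[where p = "[:x * cnj x, - (x + cnj x), 1:]"])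
    show "\<forall>i. coeff [:x * cnj x, - (x + cnj x), 1:] i \<in> \<int>"
      using * Ints_minus[of "x + cnj x"] by (auto simp: coeff_pCons split: nat.splits)
  qed (simp_all add: algebra_simps)
qed

text \<open>The traces of \<open>x * y\<close> and \<open>x * cnj y\<close> are the two roots of a monic integral quadratic.\<close>

lemma mixed_traces_Ints:
  assumes "x \<in> K" "y \<in> K" "algebraic_int x" "algebraic_int y"
  shows "x * y + cnj x * cnj y \<in> \<int>" "x * cnj y + cnj x * y \<in> \<int>"
proof -
  define s t where "s = x + cnj x" and "t = y + cnj y"
  define m n where "m = x * cnj x" and "n = y * cnj y"
  have int: "s \<in> \<int>" "t \<in> \<int>" "m \<in> \<int>" "n \<in> \<int>"
    using assms algebraic_int_iff by (auto simp: s_def t_def m_def n_def)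
  \<comment> \<open>The two traces have sum \<open>s * t\<close> and product
    \<open>n * (x^2 + (cnj x)^2) + m * (y^2 + (cnj y)^2)\<close>, where
    \<open>x^2 + (cnj x)^2 = s^2 - 2 * m\<close> and likewise for \<open>y\<close>.\<close>
  define p where "p = [:n * (s\<^sup>2 - 2 * m) + m * (t\<^sup>2 - 2 * n), - (s * t), 1:]"
  have p: "lead_coeff p = 1" "\<forall>i. coeff p i \<in> \<int>"
    using int by (auto simp: p_def coeff_pCons split: nat.splits intro!: Ints_add Ints_mult Ints_diff Ints_power)
  have "algebraic_int (x * y + cnj x * cnj y)"
    by (rule algebraic_int.intros[OF p])
      (simp add: p_def s_def t_def m_def n_def algebra_simps power2_eq_square)
  moreover have "algebraic_int (x * cnj y + cnj x * y)"
    by (rule algebraic_int.intros[OF p])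
      (simp add: p_def s_def t_def m_def n_def algebra_simps power2_eq_square)
  moreover have "x * y + cnj x * cnj y \<in> \<rat>" "x * cnj y + cnj x * y \<in> \<rat>"
    using trace_norm_Rats(1)[of "x * y"] trace_norm_Rats(1)[of "x * cnj y"] assms by auto
  ultimately show "x * y + cnj x * cnj y \<in> \<int>" "x * cnj y + cnj x * y \<in> \<int>"
    by (auto intro: rational_algebraic_int_is_int)
qed

section \<open>The ring of integers and its ideals\<close>

abbreviation OK :: "complex ring" where "OK \<equiv> ring_of_integers K"
definition ints :: "complex set" where "ints = {x \<in> K. algebraic_int x}"

lemma mem_ints: "x \<in> ints \<longleftrightarrow> x \<in> K \<and> algebraic_int x"
  by (simp add: ints_def)

text \<open>Of the four traces and norms to be checked, two involve cross terms: the trace of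
  \<open>x * y\<close> and the norm of \<open>x + y\<close>. These are the two values in
  \<open>mixed_traces_Ints\<close>.\<close>

lemma subring_ints: "subring ints complex_field"
proof (rule complex_field.subringI)
  fix x y assume xy: "x \<in> ints" "y \<in> ints"
  then have int: "x + cnj x \<in> \<int>" "x * cnj x \<in> \<int>" "y + cnj y \<in> \<int>" "y * cnj y \<in> \<int>"
    using algebraic_int_iff by (auto simp: mem_ints)
  have xy': "x \<in> K" "y \<in> K" using xy by (simp_all add: mem_ints)
  note mixed = mixed_traces_Ints[of x y] xy[unfolded mem_ints]
  have "(x * y) * cnj (x * y) = (x * cnj x) * (y * cnj y)" by simp
  then have "(x * y) * cnj (x * y) \<in> \<int>" using int by (metis Ints_mult)
  then show "x \<otimes>\<^bsub>complex_field\<^esub> y \<in> ints"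
    using xy' mixed by (simp add: algebraic_int_iff mem_ints)
  have "(x + y) + cnj (x + y) = (x + cnj x) + (y + cnj y)" by simp
  moreover have "(x + y) * cnj (x + y) = x * cnj x + y * cnj y + (x * cnj y + cnj x * y)"
    by (simp add: algebra_simps)
  ultimately have "(x + y) + cnj (x + y) \<in> \<int>" "(x + y) * cnj (x + y) \<in> \<int>"
    using int mixed by (simp_all only: Ints_add)
  then show "x \<oplus>\<^bsub>complex_field\<^esub> y \<in> ints"
    using xy' by (simp add: algebraic_int_iff mem_ints)
qed (auto simp: mem_ints)

lemma OK_simps [simp]:
  "carrier OK = ints" "monoid.mult OK = (*)" "ring.add OK = (+)" "monoid.one OK = 1" "ring.zero OK = 0"
  by (simp_all add: ring_of_integers_def ints_def)

sublocale OK: domain OK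
  unfolding ring_of_integers_def ints_def[symmetric] by (rule complex_field.subring_is_domain[OF subring_ints])

lemma ints_closed [intro]:
  shows "\<And>x y. x \<in> ints \<Longrightarrow> y \<in> ints \<Longrightarrow> x + y \<in> ints"
    "\<And>x y. x \<in> ints \<Longrightarrow> y \<in> ints \<Longrightarrow> x - y \<in> ints"
    "\<And>x y. x \<in> ints \<Longrightarrow> y \<in> ints \<Longrightarrow> x * y \<in> ints"
    "\<And>x. x \<in> ints \<Longrightarrow> - x \<in> ints" "\<And>x n. x \<in> ints \<Longrightarrow> x ^ n \<in> ints"
    "\<And>x. x \<in> ints \<Longrightarrow> cnj x \<in> ints" "\<And>n. numeral n \<in> ints" "1 \<in> ints" "0 \<in> ints"
proof -
  show add: "x + y \<in> ints" if "x \<in> ints" "y \<in> ints" for x y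
    using OK.a_closed that by simp
  show minus: "- x \<in> ints" if "x \<in> ints" for x
    using that by (auto simp: mem_ints)
  show "x - y \<in> ints" if "x \<in> ints" "y \<in> ints" for x y
    using add[OF that(1) minus[OF that(2)]] by simp
  show mult: "x * y \<in> ints" if "x \<in> ints" "y \<in> ints" for x y
    using OK.m_closed that by simp
  show "x ^ n \<in> ints" if "x \<in> ints" for x n
    using that by (induction n) (use mult in \<open>auto simp: mem_ints\<close>)
  show "cnj x \<in> ints" if "x \<in> ints" for x
    using that by (auto simp: mem_ints)
  show "numeral n \<in> ints" for n
    by (auto simp: mem_ints intro: int_imp_algebraic_int)
qed (auto simp: mem_ints)

lemma cgenideal_OK: "PIdl\<^bsub>OK\<^esub> a = {y * a |y. y \<in> ints}"
  by (simp add: cgenideal_def)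

text \<open>Multiplying by an integer \<open>m\<close> multiplies the trace by \<open>m\<close> and
  the norm by \<open>m^2\<close>, so a common denominator of trace and norm serves as denominator of
  \<open>d\<close>.\<close>

lemma ints_numerator:
  assumes "d \<in> K"
  obtains a b where "a \<in> ints" "b \<in> ints" "b \<noteq> 0" "d = a / b"
proof -
  obtain r s where rs: "d + cnj d = of_int r / of_int s" "s > 0"
    using trace_norm_Rats(1)[OF assms] by (rule Rats_cases')
  obtain u v where uv: "d * cnj d = of_int u / of_int v" "v > 0"
    using trace_norm_Rats(2)[OF assms] by (rule Rats_cases')
  define m :: complex where "m = of_int (s * v)"
  have m: "m \<noteq> 0" "m \<in> K" "cnj m = m" "m \<in> \<int>" using rs uv by (auto simp: m_def)
  have "m * d + cnj (m * d) = m * (d + cnj d)" using m by (simp add: algebra_simps)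
  also have "\<dots> = of_int (r * v)" using rs by (simp add: m_def)
  finally have 1: "m * d + cnj (m * d) \<in> \<int>" by (metis Ints_of_int)
  have "(m * d) * cnj (m * d) = m * m * (d * cnj d)" using m by (simp add: algebra_simps)
  also have "\<dots> = of_int (s * v * s * u)" using uv by (simp add: m_def)
  finally have 2: "(m * d) * cnj (m * d) \<in> \<int>" by (metis Ints_of_int)
  have "m * d \<in> ints" using 1 2 m assms algebraic_int_iff[of "m * d"] by (auto simp: mem_ints)
  moreover have "m \<in> ints" using m int_imp_algebraic_int by (auto simp: mem_ints)
  ultimately show thesis using that[of "m * d" m] m(1) by simp
qed

lemma ideal_closed:
  assumes "ideal I OK"
  shows "I \<subseteq> ints" "0 \<in> I" "\<And>x y. x \<in> I \<Longrightarrow> y \<in> I \<Longrightarrow> x + y \<in> I"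
    "\<And>x y. x \<in> I \<Longrightarrow> y \<in> I \<Longrightarrow> x - y \<in> I"
    "\<And>x y. x \<in> ints \<Longrightarrow> y \<in> I \<Longrightarrow> x * y \<in> I"
    "\<And>x y. x \<in> ints \<Longrightarrow> y \<in> I \<Longrightarrow> y * x \<in> I"
proof -
  interpret ideal I OK by (rule assms)
  show sub: "I \<subseteq> ints" using a_subset by simp
  show "0 \<in> I" using zero_closed by simp
  show add: "x + y \<in> I" if "x \<in> I" "y \<in> I" for x y
    using a_closed that by simp
  have minus: "- x \<in> I" if "x \<in> I" for x
    using I_l_closed[OF that, of "- 1"] ints_closed(4,8) by simp
  show "x - y \<in> I" if "x \<in> I" "y \<in> I" for x y
    using add[OF that(1) minus[OF that(2)]] by simp
  show "x * y \<in> I" if "x \<in> ints" "y \<in> I" for x y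
    using I_l_closed[OF that(2)] that(1) by simp
  then show "y * x \<in> I" if "x \<in> ints" "y \<in> I" for x y
    using that by (simp add: mult.commute)
qed

lemma primeideal_closed:
  assumes "primeideal p OK"
  shows "1 \<notin> p" "\<And>x y. x \<in> ints \<Longrightarrow> y \<in> ints \<Longrightarrow> x * y \<in> p \<Longrightarrow> x \<in> p \<or> y \<in> p"
    "\<And>x n. x \<in> ints \<Longrightarrow> x ^ n \<in> p \<Longrightarrow> x \<in> p"
proof -
  interpret primeideal p OK by (rule assms)
  show one: "1 \<notin> p" using I_notcarr one_imp_carrier by auto
  show prime: "x \<in> p \<or> y \<in> p" if "x \<in> ints" "y \<in> ints" "x * y \<in> p" for x y
    using I_prime that by simp
  show "x \<in> p" if "x \<in> ints" "x ^ n \<in> p" for x n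
    using that(2) by (induction n) (use one prime that(1) ints_closed(5) in auto)
qed

end

section \<open>Consequences of class number one\<close>

locale class_number_one = imaginary_quadratic +
  assumes class_number_one: "class_number K = 1"
begin

text \<open>With a single ideal class, \<open>I\<close> is equivalent to the whole ring, so
  \<open>\<alpha> I = \<beta> ints\<close>. The element \<open>\<beta> * 1\<close> on the right
  equals \<open>\<alpha> * x\<close> for some \<open>x \<in> I\<close>, and cancelling
  \<open>\<alpha>\<close> shows that \<open>x\<close> generates \<open>I\<close>.\<close>

lemma ideal_principal:
  assumes "ideal I OK" "I \<noteq> {0}"
  obtains x where "x \<in> ints" "I = (\<lambda>y. y * x) ` ints"
proof -
  let ?r = "ideal_equivalence K"
  have carrier: "ints \<in> nonzero_ideals K"
    using OK.oneideal ints_closed(8) by (auto simp: nonzero_ideals_def)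
  have I: "I \<in> nonzero_ideals K"
    using assms by (simp add: nonzero_ideals_def)
  obtain C where C: "nonzero_ideals K // ?r = {C}"
    using class_number_one unfolding class_number_def by (rule card_1_singletonE)
  have "?r `` {I} = C" "?r `` {ints} = C"
    using quotientI[OF I, of ?r] quotientI[OF carrier, of ?r] unfolding C by simp_all
  moreover have "(ints, ints) \<in> ?r"
    unfolding ideal_equivalence_def using carrier ints_closed(8)
    by (auto intro!: bexI[of _ 1])
  ultimately have "(I, ints) \<in> ?r" by auto
  then obtain \<alpha> \<beta> where ab: "\<alpha> \<noteq> 0" "\<beta> \<noteq> 0" "\<alpha> \<in> ints" "\<beta> \<in> ints"
      "(\<lambda>x. \<alpha> * x) ` I = (\<lambda>x. \<beta> * x) ` ints"
    by (auto simp: ideal_equivalence_def)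
  have "\<beta> * 1 \<in> (\<lambda>x. \<alpha> * x) ` I" unfolding ab(5) by (rule imageI) auto
  then obtain x where x: "x \<in> I" "\<beta> = \<alpha> * x" by auto
  have "I \<subseteq> (\<lambda>y. y * x) ` ints"
  proof
    fix y assume "y \<in> I"
    then have "\<alpha> * y \<in> (\<lambda>x. \<beta> * x) ` ints" unfolding ab(5)[symmetric] by (rule imageI)
    then obtain z where "z \<in> ints" "\<alpha> * y = \<alpha> * (z * x)" using x by auto
    then show "y \<in> (\<lambda>y. y * x) ` ints" using ab(1) by auto
  qed
  moreover have "(\<lambda>y. y * x) ` ints \<subseteq> I"
    using ideal_closed(5)[OF assms(1)] x by auto
  ultimately show thesis using that x ideal_closed(1)[OF assms(1)] by blast
qed

sublocale OK: principal_domain OK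
proof
  fix I assume I: "ideal I OK"
  show "\<exists>a \<in> carrier OK. I = PIdl\<^bsub>OK\<^esub> a"
  proof (cases "I = {0}")
    case True
    then have "I = PIdl\<^bsub>OK\<^esub> 0" by (auto simp: cgenideal_OK intro!: exI[of _ 0])
    then show ?thesis by auto
  next
    case False
    then obtain x where "x \<in> ints" "I = (\<lambda>y. y * x) ` ints" using ideal_principal I by blast
    then have "I = PIdl\<^bsub>OK\<^esub> x" by (auto simp: cgenideal_OK)
    then show ?thesis using \<open>x \<in> ints\<close> by auto
  qed
qed

text \<open>A generator \<open>g\<close> of the ideal of \<open>a\<close> and \<open>b\<close>
  divides both and is a combination of both; dividing by \<open>g\<close> turns that combination
  into the Bezout relation.\<close>

lemma lowest_terms:
  assumes "d \<in> K"
  obtains a b x y where "a \<in> ints" "b \<in> ints" "x \<in> ints" "y \<in> ints" "b \<noteq> 0" "d = a / b"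
    "x * a + y * b = 1"
proof -
  obtain a b where ab: "a \<in> ints" "b \<in> ints" "b \<noteq> 0" "d = a / b"
    using ints_numerator[OF assms] .
  let ?I = "PIdl\<^bsub>OK\<^esub> a <+>\<^bsub>OK\<^esub> PIdl\<^bsub>OK\<^esub> b"
  have I: "?I = {x * a + y * b |x y. x \<in> ints \<and> y \<in> ints}"
    by (auto simp: cgenideal_OK set_add_def set_mult_def)
  have "ideal ?I OK"
    using ab by (intro OK.add_ideals OK.cgenideal_ideal) auto
  then obtain g where g: "g \<in> ints" "?I = PIdl\<^bsub>OK\<^esub> g" using OK.exists_gen by auto
  have "1 * a + 0 * b \<in> ?I" "0 * a + 1 * b \<in> ?I"
    unfolding I using ints_closed(8,9) by blast+
  then have "a \<in> PIdl\<^bsub>OK\<^esub> g" "b \<in> PIdl\<^bsub>OK\<^esub> g" using g(2) by simp_all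
  then obtain a' b' where *: "a' \<in> ints" "b' \<in> ints" "a = a' * g" "b = b' * g"
    by (auto simp: cgenideal_OK)
  have "g \<in> ?I" unfolding g(2) using OK.cgenideal_self g(1) by simp
  then obtain x y where xy: "x \<in> ints" "y \<in> ints" "g = x * a + y * b"
    unfolding I by blast
  have "g \<noteq> 0" using * ab by auto
  have "g * (x * a' + y * b') = x * (a' * g) + y * (b' * g)" by (simp add: algebra_simps)
  also have "\<dots> = g * 1"
    by (simp only: *(3,4)[symmetric] xy(3)[symmetric] mult_1_right)
  finally have "g * (x * a' + y * b') = g * 1" .
  then have "x * a' + y * b' = 1" using \<open>g \<noteq> 0\<close> by simp
  moreover have "d = a' / b'" unfolding ab(4) *(3,4) using \<open>g \<noteq> 0\<close> by simp
  moreover have "b' \<noteq> 0" using *(4) ab(3) by auto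
  ultimately show thesis using that[OF *(1,2) xy(1,2)] by blast
qed

text \<open>An irreducible divisor generates a maximal ideal. This is how a non-unit among the
  parameters produces a prime at which the reduction can be tested.\<close>

lemma exists_prime_containing:
  assumes "a \<in> ints" "a \<noteq> 0" "inverse a \<notin> ints"
  obtains p where "p \<in> nonzero_primes K" "a \<in> p"
proof -
  have "a \<notin> Units OK"
  proof
    assume "a \<in> Units OK"
    then obtain b where "b \<in> ints" "b * a = 1" by (auto simp: Units_def)
    then show False using assms by (simp add: inverse_unique mult.commute)
  qed
  moreover have "a \<in> carrier OK - {\<zero>\<^bsub>OK\<^esub>}" using assms by simp
  ultimately obtain b
    where b: "b \<in> carrier OK" "ring_irreducible\<^bsub>OK\<^esub> b" "b divides\<^bsub>OK\<^esub> a"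
    using OK.exists_irreducible_divisor by blast
  have "primeideal (PIdl\<^bsub>OK\<^esub> b) OK"
    by (rule OK.maximalideal_prime[OF OK.irreducible_imp_maximalideal[OF b(1,2)]])
  moreover have "b \<in> PIdl\<^bsub>OK\<^esub> b" using b(1) by (rule OK.cgenideal_self)
  moreover have "b \<noteq> 0" using OK.ring_irreducibleE(1)[OF b(1,2)] by simp
  moreover have "a \<in> PIdl\<^bsub>OK\<^esub> b"
    using b(3) by (auto simp: factor_def cgenideal_OK mult.commute)
  ultimately have "PIdl\<^bsub>OK\<^esub> b \<in> nonzero_primes K" "a \<in> PIdl\<^bsub>OK\<^esub> b"
    by (auto simp: nonzero_primes_def)
  then show thesis by (rule that)
qed

text \<open>The generator of \<open>q\<close> is prime, hence irreducible, so \<open>q\<close> is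
  maximal. The lemma upgrades an inclusion of primes to an equality when bad primes are
  compared.\<close>

lemma nonzero_prime_maximal:
  assumes "p \<in> nonzero_primes K" "q \<in> nonzero_primes K" "q \<subseteq> p"
  shows "p = q"
proof -
  have p: "primeideal p OK" and q: "primeideal q OK" "q \<noteq> {0}"
    using assms by (auto simp: nonzero_primes_def)
  have ideals: "ideal p OK" "ideal q OK" using p q primeideal.axioms(1) by blast+
  obtain a where a: "a \<in> carrier OK" "q = PIdl\<^bsub>OK\<^esub> a" using OK.exists_gen ideals by blast
  have "a \<noteq> 0" using a q(2) by (auto simp: cgenideal_OK) 
  then have "ring_prime\<^bsub>OK\<^esub> a" using OK.primeideal_iff_prime[of a] q a by auto
  then have "maximalideal q OK"
    using OK.irreducible_imp_maximalideal OK.primeness_condition a by auto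
  moreover have "p \<noteq> carrier OK" using primeideal.I_notcarr[OF p] by auto
  ultimately show ?thesis
    using maximalideal.I_maximal[of q OK p] assms(3) ideals(1) ideal_closed(1) by auto
qed

end

section \<open>Weierstrass curves\<close>

text \<open>The relations of \<open>isomorphic_over\<close> with the parameters exposed, so that
  changes can be composed and applied to points.\<close>

definition change_coords :: "'a::field \<Rightarrow> 'a \<Rightarrow> 'a \<Rightarrow> 'a \<Rightarrow> 'a weierstrass \<Rightarrow> 'a weierstrass \<Rightarrow> bool" where
  "change_coords u r s t E E' \<longleftrightarrow> u \<noteq> 0 \<and>
     u * wa1 E' = wa1 E + 2 * s \<and>
     u^2 * wa2 E' = wa2 E - s * wa1 E + 3 * r - s^2 \<and>
     u^3 * wa3 E' = wa3 E + r * wa1 E + 2 * t \<and>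
     u^4 * wa4 E' = wa4 E - s * wa3 E + 2 * r * wa2 E - (t + r * s) * wa1 E + 3 * r^2
                      - 2 * s * t \<and>
     u^6 * wa6 E' = wa6 E + r * wa4 E + r^2 * wa2 E + r^3 - t * wa3 E - t^2 - r * t * wa1 E"

lemma isomorphic_over_iff:
  "isomorphic_over K E E' \<longleftrightarrow> (\<exists>u\<in>K. \<exists>r\<in>K. \<exists>s\<in>K. \<exists>t\<in>K. change_coords u r s t E E')"
  by (simp add: isomorphic_over_def change_coords_def)

lemma change_coords_Weierstrass:
  "change_coords u r s t (Weierstrass a1 a2 a3 a4 a6) (Weierstrass a1' a2' a3' a4' a6') \<longleftrightarrow> u \<noteq> 0 \<and>
     u * a1' = a1 + 2 * s \<and>
     u^2 * a2' = a2 - s * a1 + 3 * r - s^2 \<and>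
     u^3 * a3' = a3 + r * a1 + 2 * t \<and>
     u^4 * a4' = a4 - s * a3 + 2 * r * a2 - (t + r * s) * a1 + 3 * r^2 - 2 * s * t \<and>
     u^6 * a6' = a6 + r * a4 + r^2 * a2 + r^3 - t * a3 - t^2 - r * t * a1"
  by (simp add: change_coords_def)

text \<open>Among the invariants \<open>b2\<close>, \<open>b4\<close>, \<open>b6\<close>,
  \<open>b8\<close> a change of coordinates involves only \<open>r\<close>, apart from the weights
  in \<open>u\<close>, which keeps the identities small. The discriminant needs in addition the
  relation \<open>4 * b8 = b2 * b6 - b4^2\<close>.\<close>

lemma change_coords_c4_discr:
  assumes "change_coords u r s t E E'"
  shows "u ^ 4 * c4 E' = c4 E" "u ^ 12 * discr E' = discr E"
proof -
  obtain a1 a2 a3 a4 a6 where E: "E = Weierstrass a1 a2 a3 a4 a6" by (cases E)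
  obtain a1' a2' a3' a4' a6' where E': "E' = Weierstrass a1' a2' a3' a4' a6'" by (cases E')
  have eqs: "u * a1' = a1 + 2 * s" "u^2 * a2' = a2 - s * a1 + 3 * r - s^2"
     "u^3 * a3' = a3 + r * a1 + 2 * t"
     "u^4 * a4' = a4 - s * a3 + 2 * r * a2 - (t + r * s) * a1 + 3 * r^2 - 2 * s * t"
     "u^6 * a6' = a6 + r * a4 + r^2 * a2 + r^3 - t * a3 - t^2 - r * t * a1"
    using assms unfolding E E' change_coords_Weierstrass by auto
  obtain B2 B4 B6 B8 where B: "B2 = b2 E" "B4 = b4 E" "B6 = b6 E" "B8 = b8 E" by blast
  obtain B2' B4' B6' B8' where B': "B2' = b2 E'" "B4' = b4 E'" "B6' = b6 E'" "B8' = b8 E'" by blast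
  note defs = B B' E E' b2_def b4_def b6_def b8_def weierstrass.sel
  have b2: "u^2 * B2' = B2 + 12 * r"
  proof -
    have "u^2 * B2' = (u * a1')^2 + 4 * (u^2 * a2')"
      unfolding defs by Groebner_Basis.algebra
    also have "\<dots> = B2 + 12 * r" unfolding eqs defs by Groebner_Basis.algebra
    finally show ?thesis .
  qed
  have b4: "u^4 * B4' = B4 + r * B2 + 6 * r^2"
  proof -
    have "u^4 * B4' = 2 * (u^4 * a4') + (u * a1') * (u^3 * a3')"
      unfolding defs by Groebner_Basis.algebra
    also have "\<dots> = B4 + r * B2 + 6 * r^2" unfolding eqs defs by Groebner_Basis.algebra
    finally show ?thesis .
  qed
  have b6: "u^6 * B6' = B6 + 2 * r * B4 + r^2 * B2 + 4 * r^3"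
  proof -
    have "u^6 * B6' = (u^3 * a3')^2 + 4 * (u^6 * a6')"
      unfolding defs by Groebner_Basis.algebra
    also have "\<dots> = B6 + 2 * r * B4 + r^2 * B2 + 4 * r^3" unfolding eqs defs by Groebner_Basis.algebra
    finally show ?thesis .
  qed
  have b8: "u^8 * B8' = B8 + 3 * r * B6 + 3 * r^2 * B4 + r^3 * B2 + 3 * r^4"
  proof -
    have "u^8 * B8' = (u * a1')^2 * (u^6 * a6') + 4 * (u^2 * a2') * (u^6 * a6')
        - (u * a1') * (u^3 * a3') * (u^4 * a4') + (u^2 * a2') * (u^3 * a3')^2 - (u^4 * a4')^2"
      unfolding defs by Groebner_Basis.algebra
    also have "\<dots> = B8 + 3 * r * B6 + 3 * r^2 * B4 + r^3 * B2 + 3 * r^4"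
      unfolding eqs defs by Groebner_Basis.algebra
    finally show ?thesis .
  qed
  have rel: "4 * B8 = B2 * B6 - B4^2"
    unfolding defs by Groebner_Basis.algebra
  show "u ^ 4 * c4 E' = c4 E"
  proof -
    have "u ^ 4 * c4 E' = (u^2 * B2')^2 - 24 * (u^4 * B4')"
      unfolding c4_def B'[symmetric] by Groebner_Basis.algebra
    also have "\<dots> = c4 E" unfolding c4_def B[symmetric] b2 b4 by Groebner_Basis.algebra
    finally show ?thesis .
  qed
  have "u ^ 12 * discr E' = - ((u^2 * B2')^2 * (u^8 * B8')) - 8 * (u^4 * B4')^3
      - 27 * (u^6 * B6')^2 + 9 * (u^2 * B2') * (u^4 * B4') * (u^6 * B6')"
    unfolding discr_def B'[symmetric] by Groebner_Basis.algebra
  then show "u ^ 12 * discr E' = discr E"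
    unfolding b2 b4 b6 b8 discr_def B[symmetric] using rel by Groebner_Basis.algebra
qed

text \<open>The composite parameters arise by inserting \<open>x' = u'^2 x'' + r'\<close> and
  \<open>y' = u'^3 y'' + u'^2 s' x'' + t'\<close> into the first substitution.\<close>

lemma change_coords_trans:
  assumes "change_coords u r s t E E'" "change_coords u' r' s' t' E' E''"
  shows "change_coords (u * u') (r + u^2 * r') (s + u * s') (t + u^3 * t' + u^2 * s * r') E E''"
proof -
  obtain a1 a2 a3 a4 a6 where E: "E = Weierstrass a1 a2 a3 a4 a6" by (cases E)
  obtain a1' a2' a3' a4' a6' where E': "E' = Weierstrass a1' a2' a3' a4' a6'" by (cases E')
  obtain d1 d2 d3 d4 d6 where E'': "E'' = Weierstrass d1 d2 d3 d4 d6" by (cases E'')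
  have 1: "u \<noteq> 0" "u * a1' = a1 + 2 * s" "u^2 * a2' = a2 - s * a1 + 3 * r - s^2"
     "u^3 * a3' = a3 + r * a1 + 2 * t"
     "u^4 * a4' = a4 - s * a3 + 2 * r * a2 - (t + r * s) * a1 + 3 * r^2 - 2 * s * t"
     "u^6 * a6' = a6 + r * a4 + r^2 * a2 + r^3 - t * a3 - t^2 - r * t * a1"
    using assms(1) unfolding E E' change_coords_Weierstrass by auto
  have 2: "u' \<noteq> 0" "u' * d1 = a1' + 2 * s'" "u'^2 * d2 = a2' - s' * a1' + 3 * r' - s'^2"
     "u'^3 * d3 = a3' + r' * a1' + 2 * t'"
     "u'^4 * d4 = a4' - s' * a3' + 2 * r' * a2' - (t' + r' * s') * a1' + 3 * r'^2 - 2 * s' * t'"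
     "u'^6 * d6 = a6' + r' * a4' + r'^2 * a2' + r'^3 - t' * a3' - t'^2 - r' * t' * a1'"
    using assms(2) unfolding E' E'' change_coords_Weierstrass by auto
  show ?thesis unfolding E E'' change_coords_Weierstrass
  proof (intro conjI)
    show "u * u' \<noteq> 0" using 1(1) 2(1) by simp
    show "u * u' * d1 = a1 + 2 * (s + u * s')" using 1(2) 2(2) by Groebner_Basis.algebra
    show "(u * u')^2 * d2 = a2 - (s + u * s') * a1 + 3 * (r + u^2 * r') - (s + u * s')^2"
      using 1(2,3) 2(3) by Groebner_Basis.algebra
    show "(u * u')^3 * d3 = a3 + (r + u^2 * r') * a1 + 2 * (t + u^3 * t' + u^2 * s * r')"
      using 1(2,4) 2(4) by Groebner_Basis.algebra
    show "(u * u')^4 * d4 = a4 - (s + u * s') * a3 + 2 * (r + u^2 * r') * a2 -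
        (t + u^3 * t' + u^2 * s * r' + (r + u^2 * r') * (s + u * s')) * a1 + 3 * (r + u^2 * r')^2 -
        2 * (s + u * s') * (t + u^3 * t' + u^2 * s * r')"
    proof -
      have "(u * u')^4 * d4 = u^4 * (u'^4 * d4)" by (simp add: power_mult_distrib)
      also have "\<dots> = u^4 * a4' - u * s' * (u^3 * a3') + 2 * (u^2 * r') * (u^2 * a2')
          - (u^3 * t' + u^2 * r' * (u * s')) * (u * a1') + 3 * (u^2 * r')^2 - 2 * (u * s') * (u^3 * t')"
        unfolding 2(5) by Groebner_Basis.algebra
      finally show ?thesis unfolding 1(2-5) by Groebner_Basis.algebra
    qed
    show "(u * u')^6 * d6 = a6 + (r + u^2 * r') * a4 + (r + u^2 * r')^2 * a2 + (r + u^2 * r')^3 -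
        (t + u^3 * t' + u^2 * s * r') * a3 - (t + u^3 * t' + u^2 * s * r')^2 -
        (r + u^2 * r') * (t + u^3 * t' + u^2 * s * r') * a1"
    proof -
      have "(u * u')^6 * d6 = u^6 * (u'^6 * d6)" by (simp add: power_mult_distrib)
      also have "\<dots> = u^6 * a6' + (u^2 * r') * (u^4 * a4') + (u^2 * r')^2 * (u^2 * a2') + (u^2 * r')^3
          - (u^3 * t') * (u^3 * a3') - (u^3 * t')^2 - (u^2 * r') * (u^3 * t') * (u * a1')"
        unfolding 2(6) by Groebner_Basis.algebra
      finally show ?thesis unfolding 1(2-6) by Groebner_Basis.algebra
    qed
  qed
qed

lemma (in complex_subfield) isomorphic_over_trans:
  assumes "isomorphic_over K E E'" "isomorphic_over K E' E''"
  shows "isomorphic_over K E E''"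
proof -
  obtain u r s t where 1: "u \<in> K" "r \<in> K" "s \<in> K" "t \<in> K" "change_coords u r s t E E'"
    using assms(1) unfolding isomorphic_over_iff by blast
  obtain u' r' s' t' where 2: "u' \<in> K" "r' \<in> K" "s' \<in> K" "t' \<in> K" "change_coords u' r' s' t' E' E''"
    using assms(2) unfolding isomorphic_over_iff by blast
  have "u * u' \<in> K" "r + u^2 * r' \<in> K" "s + u * s' \<in> K" "t + u^3 * t' + u^2 * s * r' \<in> K"
    using 1(1-4) 2(1-4) by auto
  then show ?thesis
    unfolding isomorphic_over_iff using change_coords_trans[OF 1(5) 2(5)] by blast
qed

section \<open>The chord-tangent law under a change of coordinates\<close>

fun map_coords :: "'a::field \<Rightarrow> 'a \<Rightarrow> 'a \<Rightarrow> 'a \<Rightarrow> 'a point \<Rightarrow> 'a point" where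
  "map_coords u r s t AtInfinity = AtInfinity"
| "map_coords u r s t (Affine x y) = Affine (u^2 * x + r) (u^3 * y + u^2 * s * x + t)"

lemma map_coords_eq_infinity [simp]: "map_coords u r s t P = AtInfinity \<longleftrightarrow> P = AtInfinity"
  by (cases P) auto

text \<open>\<open>map_coords\<close> is an affine map from \<open>E'\<close> to \<open>E\<close>
  that carries a line of slope \<open>l\<close> to one of slope \<open>L = u * l + s\<close>; both
  coordinates of the sum follow from this. The curve equation enters for equal abscissas, where it
  leaves only equal or opposite points.\<close>

lemma point_add_change_coords:
  assumes coords: "change_coords u r s t E E'"
    and on_curve: "P \<in> curve_points UNIV E'" "Q \<in> curve_points UNIV E'"
  shows "point_add E (map_coords u r s t P) (map_coords u r s t Q) =
    map_coords u r s t (point_add E' P Q)"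
proof (cases "P = AtInfinity \<or> Q = AtInfinity")
  case True
  then show ?thesis by (cases P; cases Q) auto
next
  case False
  then obtain x1 y1 x2 y2 where PQ: "P = Affine x1 y1" "Q = Affine x2 y2"
    by (metis point.exhaust)
  obtain a1 a2 a3 a4 a6 where E: "E = Weierstrass a1 a2 a3 a4 a6" by (cases E)
  obtain a1' a2' a3' a4' a6' where E': "E' = Weierstrass a1' a2' a3' a4' a6'" by (cases E')
  have u: "u \<noteq> 0" and
    e1: "u * a1' = a1 + 2 * s" and
    e2: "u^2 * a2' = a2 - s * a1 + 3 * r - s^2" and
    e3: "u^3 * a3' = a3 + r * a1 + 2 * t" and
    e4: "u^4 * a4' = a4 - s * a3 + 2 * r * a2 - (t + r * s) * a1 + 3 * r^2 - 2 * s * t"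
    using coords unfolding E E' change_coords_Weierstrass by auto
  define X1 X2 Y1 Y2 where XY: "X1 = u^2 * x1 + r" "X2 = u^2 * x2 + r"
    "Y1 = u^3 * y1 + u^2 * s * x1 + t" "Y2 = u^3 * y2 + u^2 * s * x2 + t"
  have X_eq: "X1 = X2 \<longleftrightarrow> x1 = x2" using u by (auto simp: XY)
  have Y_sum: "Y1 + Y2 + a1 * X2 + a3 = u^3 * (y1 + y2 + a1' * x2 + a3')" if "x1 = x2"
    using e1 e3 that unfolding XY by Groebner_Basis.algebra
  show ?thesis
  proof (cases "x1 = x2 \<and> y1 + y2 + a1' * x2 + a3' = 0")
    case True
    then have "X1 = X2 \<and> Y1 + Y2 + a1 * X2 + a3 = 0" using Y_sum X_eq by auto
    then show ?thesis
      unfolding PQ map_coords.simps XY[symmetric] E E' point_add.simps weierstrass.sel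
      using True by (simp only: simp_thms if_True map_coords.simps)
  next
    case not_neg: False
    then have not_neg': "\<not> (X1 = X2 \<and> Y1 + Y2 + a1 * X2 + a3 = 0)"
    proof (intro notI, elim conjE)
      assume X: "X1 = X2" and Y: "Y1 + Y2 + a1 * X2 + a3 = 0"
      have "x1 = x2" using X X_eq by blast
      then have "y1 + y2 + a1' * x2 + a3' = 0" using Y_sum Y u by simp
      then show False using not_neg \<open>x1 = x2\<close> by blast
    qed
    define l where "l = (if x1 = x2
      then (3 * x1^2 + 2 * a2' * x1 + a4' - a1' * y1) / (2 * y1 + a1' * x1 + a3')
      else (y2 - y1) / (x2 - x1))"
    define L where "L = (if X1 = X2
      then (3 * X1^2 + 2 * a2 * X1 + a4 - a1 * Y1) / (2 * Y1 + a1 * X1 + a3)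
      else (Y2 - Y1) / (X2 - X1))"
    have slope: "L = u * l + s"
    proof (cases "x1 = x2")
      case True
      \<comment> \<open>The difference of the two curve equations at a common abscissa factors in
        this way; the second factor is nonzero because the points are not opposite.\<close>
      have "(y1 - y2) * (y1 + y2 + a1' * x2 + a3') = 0"
        using on_curve True unfolding PQ curve_points_def E' by (simp, Groebner_Basis.algebra)
      then have "y1 = y2" using not_neg True by auto
      then have ne: "2 * y1 + a1' * x1 + a3' \<noteq> 0" using not_neg True unfolding mult_2 by simp
      define n m N M where nm: "n = 3 * x1^2 + 2 * a2' * x1 + a4' - a1' * y1"
        "m = 2 * y1 + a1' * x1 + a3'"
        "N = 3 * X1^2 + 2 * a2 * X1 + a4 - a1 * Y1" "M = 2 * Y1 + a1 * X1 + a3"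
      have "u^3 * m = 2 * (u^3 * y1) + u^2 * (u * a1') * x1 + u^3 * a3'"
        unfolding nm by Groebner_Basis.algebra
      then have M: "M = u^3 * m" unfolding nm(4) XY e1 e3 by Groebner_Basis.algebra
      have "u^4 * n = 3 * u^4 * x1^2 + 2 * u^2 * (u^2 * a2') * x1 + u^4 * a4' - u^3 * (u * a1') * y1"
        unfolding nm by Groebner_Basis.algebra
      then have "N - s * M = u^4 * n" unfolding nm(3,4) XY e1 e2 e4 by Groebner_Basis.algebra
      then have N: "N = u^4 * n + s * u^3 * m" unfolding M by Groebner_Basis.algebra
      have m: "m \<noteq> 0" using ne nm by simp
      define q where "q = n / m"
      have n: "n = q * m" using m by (simp add: q_def)
      have "N = (u * q + s) * M" unfolding N M n by Groebner_Basis.algebra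
      moreover have "M \<noteq> 0" using m u by (simp add: M)
      ultimately have "N / M = u * (n / m) + s" by (simp add: q_def)
      then show ?thesis unfolding L_def l_def using True X_eq by (simp add: nm)
    next
      case False
      then have "l * (x2 - x1) = y2 - y1" by (simp add: l_def)
      then have "Y2 - Y1 = (u * l + s) * (X2 - X1)" unfolding XY by Groebner_Basis.algebra
      moreover have "X2 - X1 \<noteq> 0" using False X_eq by auto
      ultimately show ?thesis unfolding L_def using False X_eq by simp
    qed
    define x3 where "x3 = l^2 + a1' * l - a2' - x1 - x2"
    define X3 where "X3 = L^2 + a1 * L - a2 - X1 - X2"
    have X3: "X3 = u^2 * x3 + r"
    proof -
      have "u^2 * x3 = (u * l)^2 + (u * a1') * (u * l) - u^2 * a2' - u^2 * x1 - u^2 * x2"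
        unfolding x3_def by Groebner_Basis.algebra
      then show ?thesis unfolding X3_def slope XY e1 e2 by Groebner_Basis.algebra
    qed
    have Y3: "L * (X1 - X3) - Y1 - a1 * X3 - a3 =
      u^3 * (l * (x1 - x3) - y1 - a1' * x3 - a3') + u^2 * s * x3 + t"
    proof -
      have "u^3 * (l * (x1 - x3) - y1 - a1' * x3 - a3') =
          (u * l) * (u^2 * x1 - u^2 * x3) - u^3 * y1 - (u * a1') * (u^2 * x3) - u^3 * a3'"
        by Groebner_Basis.algebra
      then show ?thesis unfolding X3 slope XY e1 e3 by Groebner_Basis.algebra
    qed
    have "point_add E (Affine X1 Y1) (Affine X2 Y2) =
      Affine X3 (L * (X1 - X3) - Y1 - a1 * X3 - a3)"
      unfolding E point_add.simps weierstrass.sel if_not_P[OF not_neg'] Let_def X3_def L_def ..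
    moreover have "point_add E' (Affine x1 y1) (Affine x2 y2) =
      Affine x3 (l * (x1 - x3) - y1 - a1' * x3 - a3')"
      unfolding E' point_add.simps weierstrass.sel if_not_P[OF not_neg] Let_def x3_def l_def ..
    moreover have "map_coords u r s t (Affine x3 (l * (x1 - x3) - y1 - a1' * x3 - a3')) =
        Affine X3 (L * (X1 - X3) - Y1 - a1 * X3 - a3)"
      unfolding map_coords.simps Y3 unfolding X3 ..
    ultimately show ?thesis
      unfolding PQ map_coords.simps(2)[of u r s t x1] map_coords.simps(2)[of u r s t x2] XY[symmetric]
      by (simp only:)
  qed
qed

text \<open>Follows the recursion of \<open>[^]\<close>, adding \<open>P\<close> on the right, so
  that powers in \<open>point_group\<close> are multiples without any appeal to
  associativity.\<close>

definition multiple :: "'a::field weierstrass \<Rightarrow> 'a point \<Rightarrow> nat \<Rightarrow> 'a point" where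
  "multiple E P n = ((\<lambda>R. point_add E R P) ^^ n) AtInfinity"

lemma multiple_0 [simp]: "multiple E P 0 = AtInfinity"
  and multiple_Suc [simp]: "multiple E P (Suc n) = point_add E (multiple E P n) P"
  by (simp_all add: multiple_def)

lemma point_group_simps [simp]:
  "carrier (point_group K E) = curve_points K E" "\<one>\<^bsub>point_group K E\<^esub> = AtInfinity"
  by (simp_all add: point_group_def)

lemma point_group_pow: "P [^]\<^bsub>point_group K E\<^esub> (n::nat) = multiple E P n"
  by (induction n) (simp_all add: nat_pow_def point_group_def)

section \<open>Tate normal form and the multiples of its marked point\<close>

definition tate :: "'a::field \<Rightarrow> 'a \<Rightarrow> 'a weierstrass" where
  "tate b c = Weierstrass (1 - c) (- b) (- b) 0 0"

lemma tate_simps [simp]: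
  "wa1 (tate b c) = 1 - c" "wa2 (tate b c) = - b" "wa3 (tate b c) = - b"
  "wa4 (tate b c) = 0" "wa6 (tate b c) = 0"
  by (simp_all add: tate_def)

lemma tate_on_curve:
  "Affine x y \<in> curve_points UNIV (tate b c) \<longleftrightarrow> y^2 + (1 - c) * x * y - b * y = x^3 - b * x^2"
  by (simp add: curve_points_def)

lemma tate_add_origin:
  fixes b c x y :: "'a::field"
  assumes "x \<noteq> 0"
  defines "x' \<equiv> (y / x)^2 + (1 - c) * (y / x) + b - x"
  shows "point_add (tate b c) (Affine x y) (Affine 0 0) = Affine x' (b - (y / x + 1 - c) * x')"
proof -
  define l where "l = y / x"
  have y: "y = l * x" using assms(1) by (simp add: l_def)
  have slope: "(0 - y) / (0 - x) = l" by (simp add: l_def)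
  have "\<not> (x = 0 \<and> y + 0 + (1 - c) * 0 + - b = 0)" using assms(1) by simp
  note add = if_not_P[OF this] if_not_P[OF assms(1)]
  have x': "l^2 + (1 - c) * l - - b - x - 0 = x'" by (simp add: x'_def l_def)
  have "l * (x - x') - y - (1 - c) * x' - - b = b - (l + 1 - c) * x'"
    unfolding y by Groebner_Basis.algebra
  then show ?thesis
    by (simp only: point_add.simps tate_simps add slope Let_def x' l_def[symmetric])
qed

lemma tate_double_origin:
  assumes "b \<noteq> 0"
  shows "point_add (tate b c) (Affine 0 0) (Affine 0 0) = Affine b (b * c)"
  using assms by (simp add: Let_def) (simp add: algebra_simps)

text \<open>The line \<open>y = l x\<close> meets the curve in the origin and two points whose abscissas have product \<open>b l\<close>.\<close>

lemma tate_add_origin_abscissa: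
  assumes "Affine x y \<in> curve_points UNIV (tate b c)" "x \<noteq> 0"
  shows "x * ((y / x)^2 + (1 - c) * (y / x) + b - x) = b * (y / x)"
proof -
  define l where "l = y / x"
  then have y: "y = l * x" using assms(2) by simp
  have "x * (x * (l^2 + (1 - c) * l + b - x)) = x * (b * l)"
    using assms(1) unfolding tate_on_curve y by Groebner_Basis.algebra
  then show ?thesis using mult_left_cancel[OF assms(2)] by (simp only: l_def)
qed

text \<open>Closure under adding the origin is enough to keep all its multiples on the curve, so
  closure under the full chord-tangent law does not arise. For abscissa 0 the point is the origin or
  its negative \<open>(0, b)\<close>.\<close>

lemma tate_add_origin_closed:
  assumes "R \<in> curve_points UNIV (tate b c)" "b \<noteq> 0"
  shows "point_add (tate b c) R (Affine 0 0) \<in> curve_points UNIV (tate b c)"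
proof (cases R)
  case AtInfinity
  then show ?thesis by (simp add: curve_points_def)
next
  case R: (Affine x y)
  show ?thesis
  proof (cases "x = 0")
    case True
    then have "y * (y - b) = 0" using assms(1) R by (simp add: tate_on_curve algebra_simps power2_eq_square)
    then consider "y = 0" | "y = b" by auto
    then show ?thesis
    proof cases
      case 1
      then show ?thesis using R True tate_double_origin[OF assms(2), of c]
        by (simp add: tate_on_curve del: point_add.simps) (simp add: algebra_simps power_numeral_reduce)
    next
      case 2
      then show ?thesis using R True by (simp add: curve_points_def)
    qed
  next
    case False
    define l x' where "l = y / x" and "x' = (y / x)^2 + (1 - c) * (y / x) + b - x"
    have 1: "x * x' = b * l"
      using tate_add_origin_abscissa assms(1) R False by (simp add: l_def x'_def)
    have 2: "x' = l^2 + (1 - c) * l + b - x" by (simp add: x'_def l_def)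
    have "(b - (l + 1 - c) * x')^2 + (1 - c) * x' * (b - (l + 1 - c) * x') - b * (b - (l + 1 - c) * x')
      = x'^3 - b * x'^2"
      using 1 2 by Groebner_Basis.algebra
    then show ?thesis
      using tate_add_origin[OF False, of b c y] R
      by (simp add: tate_on_curve l_def x'_def del: point_add.simps)
  qed
qed

lemma tate_multiple_closed:
  assumes "b \<noteq> 0"
  shows "multiple (tate b c) (Affine 0 0) n \<in> curve_points UNIV (tate b c)"
proof (induction n)
  case (Suc n)
  then show ?case unfolding multiple_Suc by (rule tate_add_origin_closed[OF _ assms])
qed (simp add: curve_points_def)

text \<open>Write P for the origin. The condition on 7P is unwound backwards: 6P has abscissa 0,
  hence 5P is \<open>(b, 0)\<close>, which is -2P, and hence 4P has ordinate \<open>c\<close> times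
  its abscissa. The resulting equation \<open>c = d^2 - d\<close> says that 3P and 4P share their
  abscissa.\<close>

lemma order_seven_tate_parameters:
  fixes b c :: "'a::field"
  assumes b: "b \<noteq> 0"
    and order: "multiple (tate b c) (Affine 0 0) 7 = AtInfinity"
      "\<And>m. 0 < m \<Longrightarrow> m < 7 \<Longrightarrow> multiple (tate b c) (Affine 0 0) m \<noteq> AtInfinity"
  obtains d where "d \<noteq> 0" "d \<noteq> 1" "c = d^2 - d" "b = d^3 - d^2"
proof -
  let ?T = "tate b c" and ?P = "Affine 0 0 :: 'a point"
  let ?m = "multiple ?T ?P"
  \<comment> \<open>\<open>(0, b)\<close> is the negative of the origin. Each of \<open>c\<close>,
    \<open>x4\<close>, \<open>x5\<close> is the abscissa of a multiple whose ordinate would be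
    \<open>b\<close> if that abscissa were 0; the next multiple would then be infinity, too
    early.\<close>
  have neg: "point_add ?T (Affine 0 b) ?P = AtInfinity" by simp
  have step: "?m (Suc n) = point_add ?T (?m n) ?P" for n by (rule multiple_Suc)
  have m1: "?m (Suc 0) = Affine 0 0" by simp
  have m2: "?m (Suc (Suc 0)) = Affine b (b * c)"
    unfolding step[of "Suc 0"] m1 by (rule tate_double_origin[OF b])
  have m3: "?m (Suc (Suc (Suc 0))) = Affine c (b - c)"
    unfolding step[of "Suc (Suc 0)"] m2 tate_add_origin[OF b] using b
    by (simp add: power2_eq_square algebra_simps)
  have c: "c \<noteq> 0"
  proof
    assume "c = 0"
    then have "?m (Suc (Suc (Suc (Suc 0)))) = AtInfinity"
      unfolding step[of "Suc (Suc (Suc 0))"] m3 using neg by simp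
    then show False using order(2)[of 4] by (simp add: numeral_eq_Suc)
  qed
  \<comment> \<open>\<open>d - 1\<close> is the slope of the line through 3P and the origin. Under
    the order condition \<open>d\<close> becomes the coordinate on X_1(7).\<close>
  define d where "d = b / c"
  have bd: "b = c * d" using c by (simp add: d_def)
  have d0: "d \<noteq> 0" using b c by (simp add: d_def)
  define x4 y4 where "x4 = d^2 - d" and "y4 = b - (d - c) * x4"
  have m4: "?m (Suc (Suc (Suc (Suc 0)))) = Affine x4 y4"
  proof -
    have l: "(b - c) / c = d - 1" using c by (simp add: d_def diff_divide_distrib)
    have x: "(d - 1)^2 + (1 - c) * (d - 1) + b - c = x4" unfolding x4_def bd by Groebner_Basis.algebra
    have y: "d - 1 + 1 - c = d - c" by simp
    show ?thesis
      unfolding step[of "Suc (Suc (Suc 0))"] m3 tate_add_origin[OF c] l x y y4_def ..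
  qed
  have x4: "x4 \<noteq> 0"
  proof
    assume "x4 = 0"
    then have "?m (Suc (Suc (Suc (Suc (Suc 0))))) = AtInfinity"
      unfolding step[of "Suc (Suc (Suc (Suc 0)))"] m4 using neg by (simp add: y4_def del: point_add.simps)
    then show False using order(2)[of 5] by (simp add: numeral_eq_Suc)
  qed
  then have d1: "d \<noteq> 1" by (auto simp: x4_def)
  define l4 where "l4 = y4 / x4"
  define x5 where "x5 = l4^2 + (1 - c) * l4 + b - x4"
  define y5 where "y5 = b - (l4 + 1 - c) * x5"
  have m5: "?m (Suc (Suc (Suc (Suc (Suc 0))))) = Affine x5 y5"
    unfolding step[of "Suc (Suc (Suc (Suc 0)))"] m4 tate_add_origin[OF x4] x5_def y5_def l4_def ..
  have x5: "x5 \<noteq> 0"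
  proof
    assume "x5 = 0"
    then have "?m (Suc (Suc (Suc (Suc (Suc (Suc 0)))))) = AtInfinity"
      unfolding step[of "Suc (Suc (Suc (Suc (Suc 0))))"] m5 using neg by (simp add: y5_def del: point_add.simps)
    then show False using order(2)[of 6] by (simp add: numeral_eq_Suc)
  qed
  define l5 where "l5 = y5 / x5"
  define x6 where "x6 = l5^2 + (1 - c) * l5 + b - x5"
  have m6: "?m (Suc (Suc (Suc (Suc (Suc (Suc 0)))))) = Affine x6 (b - (l5 + 1 - c) * x6)"
    unfolding step[of "Suc (Suc (Suc (Suc (Suc 0))))"] m5 tate_add_origin[OF x5] x6_def l5_def ..
  have m7: "point_add ?T (Affine x6 (b - (l5 + 1 - c) * x6)) ?P = AtInfinity"
    using order(1) m6 by (simp add: numeral_eq_Suc del: point_add.simps)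
  have x6: "x6 = 0" using m7 by (auto simp: Let_def split: if_splits)
  \<comment> \<open>The product of the abscissas on the chord turns \<open>x6 = 0\<close> into
    \<open>l5 = 0\<close> without expanding \<open>x6\<close> as a rational function of
    \<open>c\<close> and \<open>d\<close>.\<close>
  have "x5 * x6 = b * l5"
    using tate_add_origin_abscissa[of x5 y5 b c] x5 tate_multiple_closed[OF b, of c 5] m5
    by (simp add: numeral_eq_Suc x6_def l5_def del: point_add.simps multiple_Suc)
  then have l5: "l5 = 0" using x6 b by simp
  then have "y5 = 0" "x5 = b" using x6 x5 by (simp_all add: l5_def x6_def)
  then have "b * (c - l4) = 0" unfolding y5_def by Groebner_Basis.algebra
  then have "y4 = c * x4" using b x4 by (simp add: l4_def field_simps)
  then have "d * (c - (d^2 - d)) = 0" unfolding y4_def x4_def bd by Groebner_Basis.algebra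
  then have cd: "c = d^2 - d" using d0 by simp
  then have "b = d^3 - d^2" unfolding bd by Groebner_Basis.algebra
  then show thesis using that d0 d1 cd by blast
qed

text \<open>Moving \<open>P\<close> to the origin and its tangent to the line y = 0 leaves a
  coefficient \<open>A2\<close> of x^2 and \<open>A3\<close> of y. If \<open>A3\<close> were 0 then
  2P would be infinity, and if \<open>A2\<close> were 0 then 3P would be. Scaling by
  \<open>u = A3 / A2\<close> makes the two coefficients equal.\<close>

lemma (in complex_subfield) tate_normal_form:
  assumes E: "defined_over K E" and P: "has_order (point_group K E) P n" "n > 3"
  obtains b c where "b \<in> K" "c \<in> K" "b \<noteq> 0" "isomorphic_over K E (tate b c)"
    "\<And>m. multiple E P m = AtInfinity \<longleftrightarrow> multiple (tate b c) (Affine 0 0) m = AtInfinity"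
proof -
  obtain a1 a2 a3 a4 a6 where E_eq: "E = Weierstrass a1 a2 a3 a4 a6" by (cases E)
  have order: "multiple E P m \<noteq> AtInfinity" if "0 < m" "m < n" for m
    using P(1) that by (simp add: has_order_def point_group_pow)
  have "P \<noteq> AtInfinity" using order[of "Suc 0"] P(2) by auto
  then obtain x0 y0 where P_eq: "P = Affine x0 y0" by (cases P) auto
  then have xy: "x0 \<in> K" "y0 \<in> K"
    and on_curve: "y0^2 + a1 * x0 * y0 + a3 * y0 = x0^3 + a2 * x0^2 + a4 * x0 + a6"
    using P(1) by (auto simp: has_order_def point_group_def curve_points_def E_eq)
  have coeffs: "a1 \<in> K" "a2 \<in> K" "a3 \<in> K" "a4 \<in> K" "a6 \<in> K"
    using E by (auto simp: defined_over_def E_eq)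
  define A3 where "A3 = 2 * y0 + a1 * x0 + a3"
  define s where "s = (3 * x0^2 + 2 * a2 * x0 + a4 - a1 * y0) / A3"
  define A2 where "A2 = a2 - s * a1 + 3 * x0 - s^2"
  have A3: "A3 \<noteq> 0"
  proof
    assume "A3 = 0"
    then have "y0 + y0 + a1 * x0 + a3 = 0" unfolding A3_def mult_2 .
    then have "multiple E P (Suc (Suc 0)) = AtInfinity" by (simp add: P_eq E_eq)
    then show False using order[of "Suc (Suc 0)"] P(2) by simp
  qed
  then have s: "s * A3 = 3 * x0^2 + 2 * a2 * x0 + a4 - a1 * y0" by (simp add: s_def)
  have A2: "A2 \<noteq> 0"
  proof
    assume "A2 = 0"
    then have x: "s^2 + a1 * s - a2 - x0 - x0 = x0" unfolding A2_def by Groebner_Basis.algebra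
    have "\<not> (x0 = x0 \<and> y0 + y0 + a1 * x0 + a3 = 0)" using A3 unfolding A3_def mult_2 by simp
    note add = if_not_P[OF this]
    have "multiple E P (Suc (Suc 0)) = point_add E (Affine x0 y0) (Affine x0 y0)" by (simp add: P_eq)
    also have "\<dots> = Affine x0 (- y0 - a1 * x0 - a3)"
      unfolding E_eq point_add.simps weierstrass.sel add Let_def if_P[OF refl] A3_def[symmetric]
        s_def[symmetric] x by simp
    finally have "multiple E P (Suc (Suc 0)) = Affine x0 (- y0 - a1 * x0 - a3)" .
    then have "multiple E P (Suc (Suc (Suc 0))) = AtInfinity"
      unfolding multiple_Suc[of E P "Suc (Suc 0)"] by (simp add: P_eq E_eq)
    then show False using order[of "Suc (Suc (Suc 0))"] P(2) by simp
  qed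
  define u where "u = A3 / A2"
  define b where "b = - (A2 / u^2)"
  define c where "c = 1 - (a1 + 2 * s) / u"
  have u: "u \<noteq> 0" using A2 A3 by (simp add: u_def)
  have u': "u * A2 = A3" using A2 by (simp add: u_def)
  have ub: "u^2 * - b = A2" using u by (simp add: b_def)
  have uc: "u * (1 - c) = a1 + 2 * s" using u by (simp add: c_def)
  have coords: "change_coords u x0 s y0 E (tate b c)"
    unfolding E_eq tate_def change_coords_Weierstrass
  proof (intro conjI)
    show "u^2 * - b = a2 - s * a1 + 3 * x0 - s^2" using ub A2_def by simp
    have "u^3 * - b = u * (u^2 * - b)" by Groebner_Basis.algebra
    then show "u^3 * - b = a3 + x0 * a1 + 2 * y0" unfolding ub u' A3_def by (simp add: algebra_simps)
    show "u^4 * 0 = a4 - s * a3 + 2 * x0 * a2 - (y0 + x0 * s) * a1 + 3 * x0^2 - 2 * s * y0"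
      using s unfolding A3_def by Groebner_Basis.algebra
    show "u^6 * 0 = a6 + x0 * a4 + x0^2 * a2 + x0^3 - y0 * a3 - y0^2 - x0 * y0 * a1"
      using on_curve by Groebner_Basis.algebra
  qed (use u uc in auto)
  have K: "A3 \<in> K" "s \<in> K" "A2 \<in> K" "u \<in> K" "b \<in> K" "c \<in> K"
    using xy coeffs unfolding c_def b_def u_def A2_def s_def A3_def by auto
  have b: "b \<noteq> 0" using A2 u by (simp add: b_def)
  let ?f = "map_coords u x0 s y0"
  have mult: "multiple E P m = ?f (multiple (tate b c) (Affine 0 0) m)" for m
  proof (induction m)
    case (Suc m)
    have "P = ?f (Affine 0 0)" by (simp add: P_eq)
    then have "multiple E P (Suc m) =
        point_add E (?f (multiple (tate b c) (Affine 0 0) m)) (?f (Affine 0 0))"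
      using Suc by simp
    also have "\<dots> = ?f (point_add (tate b c) (multiple (tate b c) (Affine 0 0) m) (Affine 0 0))"
      by (intro point_add_change_coords coords tate_multiple_closed b) (simp add: curve_points_def)
    finally show ?case by simp
  qed simp
  have "isomorphic_over K E (tate b c)"
    unfolding isomorphic_over_iff using K xy coords by blast
  then show thesis using that K b mult by (metis map_coords_eq_infinity)
qed

section \<open>Bad primes\<close>

context imaginary_quadratic
begin

section \<open>Powers of ideals and the conductor\<close>

lemma nonzero_primesD:
  assumes "p \<in> nonzero_primes K"
  shows "primeideal p OK" "ideal p OK"
  using assms primeideal.axioms(1) by (auto simp: nonzero_primes_def)

lemma ideals_set_simps [simp]:
  "carrier (ideals_set OK) = {I. ideal I OK}" "monoid.mult (ideals_set OK) = ideal_prod OK"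
  "\<one>\<^bsub>ideals_set OK\<^esub> = ints"
  by (simp_all add: ideals_set_def)

lemma comm_monoid_ideals_set: "comm_monoid (ideals_set OK)"
  by (rule OK.ideals_set_is_comm_monoid)

lemma ideal_pow_ideal:
  assumes "ideal I OK"
  shows "ideal (I [^]\<^bsub>ideals_set OK\<^esub> (n::nat)) OK"
proof -
  interpret M: comm_monoid "ideals_set OK" by (rule comm_monoid_ideals_set)
  show ?thesis using M.nat_pow_closed[of I n] assms by simp
qed

lemma ideal_pow_subset:
  assumes "ideal I OK" "n > (0::nat)"
  shows "I [^]\<^bsub>ideals_set OK\<^esub> n \<subseteq> I"
proof -
  interpret M: comm_monoid "ideals_set OK" by (rule comm_monoid_ideals_set)
  obtain m where "n = Suc m" using assms(2) gr0_conv_Suc by blast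
  then have "I [^]\<^bsub>ideals_set OK\<^esub> n = (I [^]\<^bsub>ideals_set OK\<^esub> m) \<cdot>\<^bsub>OK\<^esub> I" by simp
  then show ?thesis
    using OK.ideal_prod_inter[OF ideal_pow_ideal[OF assms(1)] assms(1)] by blast
qed

lemma pow_mem_ideal_pow:
  assumes "ideal I OK" "x \<in> I"
  shows "x ^ n \<in> I [^]\<^bsub>ideals_set OK\<^esub> n"
proof -
  interpret M: comm_monoid "ideals_set OK" by (rule comm_monoid_ideals_set)
  show ?thesis
  proof (induction n)
    case 0
    then show ?case using ints_closed(8) by simp
  next
    case (Suc n)
    have "x ^ n \<otimes>\<^bsub>OK\<^esub> x \<in> (I [^]\<^bsub>ideals_set OK\<^esub> n) \<cdot>\<^bsub>OK\<^esub> I"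
      using Suc assms(2) by (rule ideal_prod.prod)
    then show ?case by (simp add: mult.commute)
  qed
qed

text \<open>Infinitely many bad primes would make \<open>finprod\<close> return the unit ideal,
  which \<open>1 \<notin> conductor K E\<close> rules out. In the remaining finite product the
  factor at \<open>p\<close> contains the whole product.\<close>

lemma conductor_subset_bad_prime:
  assumes "p \<in> nonzero_primes K" "conductor_exponent K p E > 0" "1 \<notin> conductor K E"
  shows "conductor K E \<subseteq> p"
proof -
  interpret M: comm_monoid "ideals_set OK" by (rule comm_monoid_ideals_set)
  define S where "S = {p \<in> nonzero_primes K. conductor_exponent K p E > 0}"
  define f where "f = (\<lambda>p. p [^]\<^bsub>ideals_set OK\<^esub> conductor_exponent K p E)"
  have cond: "conductor K E = finprod (ideals_set OK) f S"
    by (simp add: conductor_def S_def f_def)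
  have f: "ideal (f q) OK" if "q \<in> S" for q
    using that ideal_pow_ideal nonzero_primesD by (simp add: f_def S_def)
  have "finite S"
  proof (rule ccontr)
    assume "infinite S"
    then have "conductor K E = ints" using cond M.finprod_infinite[of S f] by simp
    then show False using assms(3) ints_closed(8) by simp
  qed
  have p: "p \<in> S" using assms by (simp add: S_def)
  have "conductor K E = finprod (ideals_set OK) f (insert p (S - {p}))"
    using cond p by (simp add: insert_absorb)
  also have "\<dots> = f p \<cdot>\<^bsub>OK\<^esub> finprod (ideals_set OK) f (S - {p})"
    using \<open>finite S\<close> f p by (subst M.finprod_insert) auto
  also have "\<dots> \<subseteq> f p"
    using OK.ideal_prod_inter[of "f p" "finprod (ideals_set OK) f (S - {p})"]
      M.finprod_closed[of f "S - {p}"] f p by auto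
  also have "f p \<subseteq> p"
    unfolding f_def using assms nonzero_primesD by (intro ideal_pow_subset) auto
  finally show ?thesis .
qed

lemma conductor_exponent_pos: "\<not> good_reduction K p E \<Longrightarrow> conductor_exponent K p E > 0"
  by (simp add: conductor_exponent_def)

section \<open>Local integrality of the j-invariant\<close>

lemma discr_c4_scale:
  assumes "isomorphic_over K E E'"
  obtains u where "u \<noteq> 0" "c4 E = u ^ 4 * c4 E'" "discr E = u ^ 12 * discr E'"
proof -
  obtain u r s t where *: "change_coords u r s t E E'"
    using assms unfolding isomorphic_over_iff by blast
  then have "u \<noteq> 0" by (simp add: change_coords_def)
  then show thesis using that change_coords_c4_discr[OF *] by simp
qed

lemma localization_closed:
  assumes p: "primeideal p OK"
  shows "x \<in> localization_at K p \<Longrightarrow> y \<in> localization_at K p \<Longrightarrow> x + y \<in> localization_at K p"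
    "x \<in> localization_at K p \<Longrightarrow> y \<in> localization_at K p \<Longrightarrow> x * y \<in> localization_at K p"
    "x \<in> ints \<Longrightarrow> x \<in> localization_at K p"
proof -
  have 0: "0 \<in> p" using ideal_closed(2) primeideal.axioms(1)[OF p] by blast
  show "x \<in> localization_at K p" if "x \<in> ints"
  proof -
    have "x = x / 1" "1 \<in> ints - p"
      using primeideal_closed(1)[OF p] ints_closed(8) by auto
    then show ?thesis unfolding localization_at_def OK_simps using that by blast
  qed
  assume x: "x \<in> localization_at K p" and y: "y \<in> localization_at K p"
  obtain a b where ab: "x = a / b" "a \<in> ints" "b \<in> ints" "b \<notin> p"
    using x unfolding localization_at_def OK_simps by blast
  obtain c d where cd: "y = c / d" "c \<in> ints" "d \<in> ints" "d \<notin> p"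
    using y unfolding localization_at_def OK_simps by blast
  have ne: "b \<noteq> 0" "d \<noteq> 0" using ab(4) cd(4) 0 by auto
  have bd: "b * d \<in> ints - p"
    using primeideal_closed(2)[OF p ab(3) cd(3)] ab(4) cd(4) ints_closed(3)[OF ab(3) cd(3)] by blast
  have "x + y = (a * d + c * b) / (b * d)" "x * y = (a * c) / (b * d)"
    unfolding ab(1) cd(1) using ne by (simp_all add: add_frac_eq)
  moreover have "a * d + c * b \<in> ints" "a * c \<in> ints"
    by (intro ints_closed(1,3) ab(2,3) cd(2,3))+
  ultimately show "x + y \<in> localization_at K p" "x * y \<in> localization_at K p"
    unfolding localization_at_def OK_simps using bd by blast+
qed

lemma c4_discr_localization:
  assumes p: "primeideal p OK" and M: "defined_over (localization_at K p) M"
  shows "c4 M \<in> localization_at K p" "discr M \<in> localization_at K p"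
proof -
  note closed = localization_closed[OF p]
  let ?L = "localization_at K p"
  have num: "numeral n \<in> ?L" for n by (rule closed(3)[OF ints_closed(7)])
  have minus: "- x \<in> ?L" if "x \<in> ?L" for x
    using closed(2)[OF closed(3)[OF ints_closed(4)[OF ints_closed(8)]] that] by simp
  have diff: "x - y \<in> ?L" if "x \<in> ?L" "y \<in> ?L" for x y
    using closed(1)[OF that(1) minus[OF that(2)]] by simp
  have power: "x ^ n \<in> ?L" if "x \<in> ?L" for x n
    using that closed(3)[OF ints_closed(8)] by (induction n) (auto intro: closed(2))
  note cl = closed(1,2) num minus diff power
  have a: "wa1 M \<in> ?L" "wa2 M \<in> ?L" "wa3 M \<in> ?L" "wa4 M \<in> ?L" "wa6 M \<in> ?L"
    using M by (auto simp: defined_over_def)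
  have b: "b2 M \<in> ?L" "b4 M \<in> ?L" "b6 M \<in> ?L" "b8 M \<in> ?L"
    unfolding b2_def b4_def b6_def b8_def by (intro cl a)+
  show "c4 M \<in> ?L" "discr M \<in> ?L"
    unfolding c4_def discr_def by (intro cl b)+
qed

text \<open>The quotient of \<open>C ^ 3\<close> by \<open>D\<close> is the \<open>j\<close>-invariant, which is integral at primes of good reduction.\<close>

lemma not_good_reduction:
  assumes p: "p \<in> nonzero_primes K"
    and CD: "C \<in> ints" "C \<notin> p" "D \<in> p" "C ^ 3 * discr E = c4 E ^ 3 * D"
  shows "\<not> good_reduction K p E"
proof
  assume "good_reduction K p E"
  then obtain M where M: "isomorphic_over K E M" "defined_over (localization_at K p) M"
    "discr M \<notin> localized_prime K p"
    by (auto simp: good_reduction_def minimal_model_at_def)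
  note prime = nonzero_primesD(1)[OF p] and ideal = nonzero_primesD(2)[OF p]
  obtain u where u: "u \<noteq> 0" "c4 E = u ^ 4 * c4 M" "discr E = u ^ 12 * discr M"
    using discr_c4_scale[OF M(1)] .
  \<comment> \<open>\<open>c4 ^ 3\<close> and \<open>discr\<close> both have weight 12, so the
    relation passes from \<open>E\<close> to the model \<open>M\<close>.\<close>
  have "u ^ 12 * (C ^ 3 * discr M) = u ^ 12 * (c4 M ^ 3 * D)"
    using CD(4) unfolding u(2,3) by Groebner_Basis.algebra
  then have eq: "C ^ 3 * discr M = c4 M ^ 3 * D" using u(1) by simp
  obtain x y where xy: "discr M = x / y" "x \<in> ints" "y \<in> ints" "y \<notin> p"
    using c4_discr_localization(2)[OF prime M(2)] by (auto simp: localization_at_def)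
  obtain s t where st: "c4 M = s / t" "s \<in> ints" "t \<in> ints" "t \<notin> p"
    using c4_discr_localization(1)[OF prime M(2)] by (auto simp: localization_at_def)
  have x: "x \<notin> p" using M(3) xy unfolding localized_prime_def OK_simps by blast
  have ne: "y \<noteq> 0" "t \<noteq> 0" using xy(4) st(4) ideal_closed(2)[OF ideal] by auto
  have x_eq: "x = discr M * y" using ne(1) xy(1) by (metis nonzero_eq_divide_eq)
  have s_eq: "s = c4 M * t" using ne(2) st(1) by (metis nonzero_eq_divide_eq)
  \<comment> \<open>Cleared of denominators, the relation puts this product into \<open>p\<close>,
    although none of \<open>C\<close>, \<open>x\<close>, \<open>t\<close> lies in
    \<open>p\<close>.\<close>
  have "C ^ 3 * x * t ^ 3 = (C ^ 3 * discr M) * (y * t ^ 3)" unfolding x_eq by (simp only: mult_ac)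
  also have "\<dots> = (s ^ 3 * y) * D" unfolding eq s_eq power_mult_distrib by (simp only: mult_ac)
  finally have "C ^ 3 * x * t ^ 3 = (s ^ 3 * y) * D" .
  moreover have "(s ^ 3 * y) * D \<in> p"
    by (rule ideal_closed(5)[OF ideal ints_closed(3)[OF ints_closed(5)[OF st(2)] xy(3)] CD(3)])
  ultimately have mem: "C ^ 3 * x * t ^ 3 \<in> p" by simp
  have int: "C ^ 3 \<in> ints" "t ^ 3 \<in> ints" using ints_closed(5) CD(1) st(3) by auto
  have "C ^ 3 * x \<in> p \<or> t ^ 3 \<in> p"
    by (rule primeideal_closed(2)[OF prime ints_closed(3)[OF int(1) xy(2)] int(2) mem])
  moreover have "C ^ 3 \<in> p \<or> x \<in> p" if "C ^ 3 * x \<in> p"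
    by (rule primeideal_closed(2)[OF prime int(1) xy(2) that])
  ultimately show False
    using primeideal_closed(3)[OF prime CD(1)] primeideal_closed(3)[OF prime st(3)] CD(2) st(4) x
    by blast
qed

text \<open>The norms of \<open>x\<close> and its inverse are integers with product 1, and a norm is
  the square of an absolute value, hence positive.\<close>

lemma unit_norm:
  assumes "x \<in> ints" "inverse x \<in> ints" "x \<noteq> 0"
  shows "x * cnj x = 1"
proof -
  have "x * cnj x \<in> \<int>" "inverse x * cnj (inverse x) \<in> \<int>"
    using assms algebraic_int_iff by (auto simp: mem_ints)
  then obtain m n where mn: "x * cnj x = of_int m" "inverse x * cnj (inverse x) = of_int n"
    by (metis Ints_cases)
  have "complex_of_int (m * n) = (x * inverse x) * cnj (x * inverse x)"
    using mn by (simp flip: mn add: mult_ac)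
  then have "m * n = 1" using assms(3) by (simp flip: of_int_mult)
  moreover have "m > 0"
  proof -
    have "complex_of_real ((cmod x)\<^sup>2) = of_int m" using mn(1) complex_norm_square by metis
    then have "(cmod x)\<^sup>2 = of_int m" by (metis of_real_eq_iff of_real_of_int_eq)
    moreover have "(cmod x)\<^sup>2 > 0" using assms(3) by simp
    ultimately show ?thesis by linarith
  qed
  ultimately have "m = 1" by (simp add: zmult_eq_1_iff)
  then show ?thesis using mn by simp
qed

text \<open>A unit lies on the unit circle, so its trace \<open>2 * Re x\<close> has absolute value
  at most 2.\<close>

lemma unit_trace:
  assumes "x \<in> ints" "inverse x \<in> ints" "x \<noteq> 0"
  obtains t :: int where "x + cnj x = of_int t" "\<bar>t\<bar> \<le> 2"
proof -
  have norm: "x * cnj x = 1" by (rule unit_norm[OF assms])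
  have "x + cnj x \<in> \<int>" using assms algebraic_int_iff by (auto simp: mem_ints)
  then obtain t where t: "x + cnj x = of_int t" by (rule Ints_cases)
  have "complex_of_real ((cmod x)\<^sup>2) = 1" using norm complex_norm_square by metis
  then have "(cmod x)\<^sup>2 = 1" by (metis of_real_1 of_real_eq_iff)
  then have "cmod x = 1 \<or> cmod x = - 1" by (simp add: power2_eq_1_iff)
  then have "cmod x = 1" using norm_ge_zero[of x] by linarith
  have "complex_of_real (2 * Re x) = of_int t" using t complex_add_cnj by metis
  then have "2 * Re x = of_int t" by (metis of_real_eq_iff of_real_of_int_eq)
  then have "\<bar>real_of_int t\<bar> \<le> 2" using abs_Re_le_cmod[of x] \<open>cmod x = 1\<close> by linarith
  then have "real_of_int \<bar>t\<bar> \<le> real_of_int 2" by simp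
  then have "\<bar>t\<bar> \<le> 2" by (simp only: of_int_le_iff)
  then show thesis using that t by blast
qed

end

text \<open>A bad prime contains the conductor, a power of \<open>q\<close>; by primality it
  contains \<open>q\<close>, and by maximality it equals \<open>q\<close>. Oddness passes to
  \<open>q\<close> because \<open>q\<close> contains the conductor.\<close>

lemma (in class_number_one) unique_bad_prime:
  assumes "prime_power_ideal K (conductor K E)" "odd_ideal K (conductor K E)"
  obtains q where "q \<in> nonzero_primes K" "2 \<notin> q"
    "\<And>p. p \<in> nonzero_primes K \<Longrightarrow> \<not> good_reduction K p E \<Longrightarrow> p = q"
proof -
  obtain q n where q: "q \<in> nonzero_primes K" "n \<ge> (1::nat)"
    "conductor K E = q [^]\<^bsub>ideals_set OK\<^esub> n"
    using assms(1) by (auto simp: prime_power_ideal_def)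
  note prime = nonzero_primesD(1)[OF q(1)] and ideal = nonzero_primesD(2)[OF q(1)]
  have sub: "conductor K E \<subseteq> q" using ideal_pow_subset[OF ideal, of n] q by simp
  have "2 \<notin> q"
  proof
    assume 2: "2 \<in> q"
    have "1 \<in> conductor K E <+>\<^bsub>OK\<^esub> (PIdl\<^bsub>OK\<^esub> 2)"
      using assms(2) ints_closed(8) by (simp add: odd_ideal_def)
    then obtain x y where "x \<in> conductor K E" "y \<in> ints" "1 = x + y * 2"
      by (auto simp: set_add_def set_mult_def cgenideal_OK)
    then have "1 \<in> q" using sub ideal_closed(3,5)[OF ideal] 2 by (metis subsetD)
    then show False using primeideal_closed(1)[OF prime] by simp
  qed
  moreover have "p = q" if p: "p \<in> nonzero_primes K" "\<not> good_reduction K p E" for p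
  proof (rule nonzero_prime_maximal[OF p(1) q(1)])
    have "1 \<notin> conductor K E" using sub primeideal_closed(1)[OF prime] by blast
    then have cond: "conductor K E \<subseteq> p"
      using conductor_subset_bad_prime p conductor_exponent_pos by blast
    show "q \<subseteq> p"
    proof
      fix x assume x: "x \<in> q"
      then have "x ^ n \<in> p" using pow_mem_ideal_pow[OF ideal x, of n] q cond by auto
      then show "x \<in> p"
        using primeideal_closed(3)[OF nonzero_primesD(1)[OF p(1)]] ideal_closed(1)[OF ideal] x by blast
    qed
  qed
  ultimately show thesis using that q(1) by blast
qed

section \<open>The parameter of a curve with a point of order 7\<close>

text \<open>The form of degree 8 obtained by homogenising, in \<open>d = a / b\<close>, the
  invariant computed in \<open>c4_discr_tate\<close>. Its quadratic factor vanishes when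
  \<open>d\<close> is a primitive sixth root of unity, where the j-invariant is 0.\<close>

definition c4_form :: "'a::comm_ring_1 \<Rightarrow> 'a \<Rightarrow> 'a" where
  "c4_form a b = (a^2 - a * b + b^2) *
     (a^6 - 11 * a^5 * b + 30 * a^4 * b^2 - 15 * a^3 * b^3 - 10 * a^2 * b^4 + 5 * a * b^5 + b^6)"

text \<open>Its roots are the three cusps of X_1(7) other than 0, 1 and infinity.\<close>

definition cubic_form :: "'a::comm_ring_1 \<Rightarrow> 'a \<Rightarrow> 'a" where
  "cubic_form a b = a^3 - 8 * a^2 * b + 5 * a * b^2 + b^3"

definition discr_form :: "'a::comm_ring_1 \<Rightarrow> 'a \<Rightarrow> 'a" where
  "discr_form a b = a^7 * b^7 * (a - b)^7 * cubic_form a b"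

lemma c4_discr_tate:
  fixes d :: "'a::field"
  shows "c4 (tate (d^3 - d^2) (d^2 - d)) = c4_form d 1"
    "discr (tate (d^3 - d^2) (d^2 - d)) = discr_form d 1"
proof -
  define b c where "b = d^3 - d^2" and "c = d^2 - d"
  have b: "b = c * d" unfolding b_def c_def by Groebner_Basis.algebra
  have b2: "b2 (tate b c) = (1 - c)^2 - 4 * b" and b4: "b4 (tate b c) = - ((1 - c) * b)"
    and b6: "b6 (tate b c) = b^2" and b8: "b8 (tate b c) = - (b^3)"
    by (simp_all add: b2_def b4_def b6_def b8_def power3_eq_cube power2_eq_square)
  have "c4 (tate b c) = c4_form d 1"
    unfolding c4_def b2 b4 unfolding b_def c_def c4_form_def power_one mult_1_right
    by Groebner_Basis.algebra
  \<comment> \<open>Splitting off \<open>b^3\<close> before expressing \<open>b\<close> and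
    \<open>c\<close> through \<open>d\<close> lowers the degree of the remaining identity.\<close>
  moreover have "discr (tate b c) = b^3 * (((1 - c)^2 - 4 * b)^2 + 8 * (1 - c)^3 - 27 * b
      - 9 * ((1 - c)^2 - 4 * b) * (1 - c))"
    unfolding discr_def b2 b4 b6 b8 by Groebner_Basis.algebra
  moreover have "((1 - c)^2 - 4 * b)^2 + 8 * (1 - c)^3 - 27 * b - 9 * ((1 - c)^2 - 4 * b) * (1 - c) =
      d * (d - 1)^4 * cubic_form d 1"
    unfolding b_def c_def cubic_form_def power_one mult_1_right by Groebner_Basis.algebra
  moreover have "b^3 = d^6 * (d - 1)^3"
    unfolding b_def by Groebner_Basis.algebra
  moreover have "d^6 * (d - 1)^3 * (d * (d - 1)^4 * cubic_form d 1) = discr_form d 1"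
    unfolding discr_form_def by (simp add: power_numeral_reduce mult_ac)
  ultimately show "c4 (tate (d^3 - d^2) (d^2 - d)) = c4_form d 1"
    "discr (tate (d^3 - d^2) (d^2 - d)) = discr_form d 1"
    unfolding b_def c_def by simp_all
qed

lemma c4_form_cyclic: "c4_form (a - b) a = c4_form a (b::'a::idom)"
  unfolding c4_form_def by Groebner_Basis.algebra

text \<open>Two signs cancel: \<open>cubic_form\<close> changes sign, and so does the odd power of
  \<open>a - b - a = - b\<close>.\<close>

lemma discr_form_cyclic: "discr_form (a - b) a = discr_form a (b::'a::idom)"
proof -
  have "cubic_form (a - b) a = - cubic_form a b"
    unfolding cubic_form_def by Groebner_Basis.algebra
  moreover have "(a - b - a)^7 = - (b^7)" by simp
  ultimately show ?thesis unfolding discr_form_def by simp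
qed

lemma c4_form_scale: "c4_form (k * a) (k * b) = k^8 * c4_form a (b::'a::idom)"
  unfolding c4_form_def by Groebner_Basis.algebra

lemma discr_form_scale: "discr_form (k * a) (k * b) = k^24 * discr_form a (b::'a::idom)"
proof -
  have "cubic_form (k * a) (k * b) = k^3 * cubic_form a b"
    unfolding cubic_form_def by Groebner_Basis.algebra
  moreover have "k * a - k * b = k * (a - b)" by (simp add: right_diff_distrib)
  moreover have "k^24 = k^7 * k^7 * k^7 * k^3" by (simp flip: power_add)
  ultimately show ?thesis
    unfolding discr_form_def by (simp only: power_mult_distrib mult_ac)
qed

text \<open>The \<open>j\<close>-invariant \<open>c4 E ^ 3 / discr E\<close> equals \<open>c4_form a b ^ 3 / discr_form a b\<close>.\<close>

definition j_parameter :: "'a::field weierstrass \<Rightarrow> 'a \<Rightarrow> 'a \<Rightarrow> bool" where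
  "j_parameter E a b \<longleftrightarrow> c4_form a b ^ 3 * discr E = c4 E ^ 3 * discr_form a b"

lemma j_parameter_cyclic: "j_parameter E a b \<Longrightarrow> j_parameter E (a - b) a"
  by (simp add: j_parameter_def c4_form_cyclic discr_form_cyclic)

text \<open>Both \<open>c4_form ^ 3\<close> and \<open>discr_form\<close> are homogeneous of degree
  24.\<close>

lemma j_parameter_scale:
  assumes "k \<noteq> 0"
  shows "j_parameter E (k * a) (k * b) \<longleftrightarrow> j_parameter E a b"
proof -
  have "(k^8)^3 = k^24" by (simp flip: power_mult)
  then have "c4_form (k * a) (k * b) ^ 3 = k^24 * c4_form a b ^ 3"
    by (simp only: c4_form_scale power_mult_distrib)
  then have "j_parameter E (k * a) (k * b) \<longleftrightarrow>
      k^24 * (c4_form a b ^ 3 * discr E) = k^24 * (c4 E ^ 3 * discr_form a b)"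
    unfolding j_parameter_def discr_form_scale by (simp only: mult_ac)
  then show ?thesis using assms by (simp add: j_parameter_def)
qed

context imaginary_quadratic
begin

text \<open>Modulo \<open>a\<close> the form \<open>c4_form a b\<close> reduces to
  \<open>b^8\<close>, which is not in \<open>p\<close>, while \<open>a\<close> divides
  \<open>discr_form a b\<close>. So the j-invariant has a pole at \<open>p\<close>.\<close>

lemma not_good_reduction_parameter:
  assumes p: "p \<in> nonzero_primes K" and j: "j_parameter E a b"
    and ab: "a \<in> p" "b \<in> ints" "b \<notin> p"
  shows "\<not> good_reduction K p E"
proof -
  note prime = nonzero_primesD(1)[OF p] and ideal = nonzero_primesD(2)[OF p]
  have a: "a \<in> ints" using ideal_closed(1)[OF ideal] ab(1) by blast
  \<comment> \<open>The quotient of \<open>c4_form a b - b^8\<close> by \<open>a\<close>, written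
    out to show that it is integral.\<close>
  define r where "r = (a - b) * b^6 + (a^2 - a * b + b^2) *
    (a^5 - 11 * a^4 * b + 30 * a^3 * b^2 - 15 * a^2 * b^3 - 10 * a * b^4 + 5 * b^5)"
  have r: "r \<in> ints" unfolding r_def by (intro ints_closed a ab(2))
  have c4: "c4_form a b = b^8 + r * a" unfolding c4_form_def r_def by Groebner_Basis.algebra
  have ra: "r * a \<in> p" by (rule ideal_closed(5)[OF ideal r ab(1)])
  show ?thesis
  proof (rule not_good_reduction[OF p _ _ _ j[unfolded j_parameter_def]])
    show "c4_form a b \<in> ints" unfolding c4_form_def by (intro ints_closed a ab(2))
    show "c4_form a b \<notin> p"
    proof
      assume "c4_form a b \<in> p"
      from ideal_closed(4)[OF ideal this ra] have "b^8 \<in> p" unfolding c4 by simp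
      then show False using primeideal_closed(3)[OF prime ab(2)] ab(3) by blast
    qed
    have "a^6 * b^7 * (a - b)^7 * cubic_form a b \<in> ints"
      unfolding cubic_form_def by (intro ints_closed a ab(2))
    then have "a^6 * b^7 * (a - b)^7 * cubic_form a b * a \<in> p"
      by (rule ideal_closed(5)[OF ideal _ ab(1)])
    also have "a^6 * b^7 * (a - b)^7 * cubic_form a b * a = discr_form a b"
      unfolding discr_form_def by (simp add: power_numeral_reduce mult_ac)
    finally show "discr_form a b \<in> p" .
  qed
qed

lemma bezout_not_in_prime:
  assumes "primeideal p OK" "x \<in> p" "y \<in> p" "u \<in> ints" "v \<in> ints" "u * x + v * y = 1"
  shows False
proof -
  note closed = ideal_closed[OF primeideal.axioms(1)[OF assms(1)]]
  have "u * x + v * y \<in> p" by (intro closed(3) closed(5) assms(2-5))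
  then show False using primeideal_closed(1)[OF assms(1)] assms(6) by simp
qed

end

section \<open>Units as parameters and their elimination\<close>

context class_number_one
begin

text \<open>The trace of the unit \<open>e\<close> is 1: trace \<open>-2\<close> or 0 would put 2 into \<open>q\<close>, and trace \<open>-1\<close> would
  put both 3 and 139 into \<open>q\<close>.\<close>

lemma unit_parameter:
  assumes q: "2 \<notin> q"
      "\<And>p. p \<in> nonzero_primes K \<Longrightarrow> \<not> good_reduction K p E \<Longrightarrow> p = q"
    and e: "e \<in> ints" "inverse e \<in> ints" "e \<noteq> 0" "e \<noteq> 1" "j_parameter E e 1"
  shows "e^2 - e + 1 = 0"
proof -
  have norm: "e * cnj e = 1" by (rule unit_norm[OF e(1-3)])
  obtain t where t: "e + cnj e = of_int t" "\<bar>t\<bar> \<le> 2" by (rule unit_trace[OF e(1-3)])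
  have cnj: "cnj e \<in> ints" by (rule ints_closed(6)[OF e(1)])
  have sq: "e^2 = of_int t * e - 1"
    using norm unfolding t(1)[symmetric] by (simp add: algebra_simps power2_eq_square)
  have unit: "e \<notin> p" if "p \<in> nonzero_primes K" for p
  proof
    assume "e \<in> p"
    then have "inverse e * e \<in> p" by (rule ideal_closed(5)[OF nonzero_primesD(2)[OF that] e(2)])
    then show False using primeideal_closed(1)[OF nonzero_primesD(1)[OF that]] e(3) by simp
  qed
  have e1: "e - 1 \<in> ints" by (intro ints_closed e(1))
  have norm1: "cnj (e - 1) * (e - 1) = 2 - of_int t"
    using norm unfolding t(1)[symmetric] by (simp add: algebra_simps)
  have "t \<noteq> 2"
  proof
    assume "t = 2"
    then have "(e - 1)^2 = 0" using sq by (simp add: power2_diff)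
    then show False using e(4) by simp
  qed
  \<comment> \<open>The norm of \<open>e - 1\<close> is \<open>2 - t\<close>. If this is not 1, some
    prime contains \<open>e - 1\<close>; the rotated parameter \<open>(e - 1, e)\<close> shows that
    it is bad, so it is \<open>q\<close>, and it contains the norm.\<close>
  have bad: "2 - of_int t \<in> q \<and> q \<in> nonzero_primes K" if "t \<noteq> 1"
  proof -
    have "inverse (e - 1) \<notin> ints"
    proof
      assume "inverse (e - 1) \<in> ints"
      then have "(e - 1) * cnj (e - 1) = 1" using unit_norm[OF e1] e(4) by simp
      then have "2 - of_int t = (1::complex)" using norm1 by (simp only: mult.commute)
      then have "of_int (2 - t) = (of_int 1::complex)" by simp
      then have "2 - t = 1" by (simp only: of_int_eq_iff)
      then show False using that by simp
    qed
    then obtain p where p: "p \<in> nonzero_primes K" "e - 1 \<in> p"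
      using exists_prime_containing[OF e1] e(4) by auto
    have "p = q"
      using not_good_reduction_parameter[OF p(1) j_parameter_cyclic[OF e(5)] p(2) e(1) unit[OF p(1)]]
        q(2)[OF p(1)] by blast
    moreover have "cnj (e - 1) * (e - 1) \<in> p"
      by (rule ideal_closed(5)[OF nonzero_primesD(2)[OF p(1)] ints_closed(6)[OF e1] p(2)])
    ultimately show ?thesis using p(1) unfolding norm1 by simp
  qed
  consider "t = 1" | "t = 0" | "t = - 2" | "t = - 1" using t(2) \<open>t \<noteq> 2\<close> by linarith
  then have "t = 1"
  proof cases
    case 2
    then show ?thesis using bad q(1) by simp
  next
    case 3
    then have "2 * 2 \<in> q" "q \<in> nonzero_primes K" using bad by simp_all
    then show ?thesis
      using primeideal_closed(2)[OF nonzero_primesD(1) ints_closed(7) ints_closed(7)] q(1) by blast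
  next
    case 4
    then have 3: "3 \<in> q" using bad by simp
    have sq: "e^2 = - e - 1" using sq 4 by simp
    \<comment> \<open>The value of \<open>cubic_form\<close> at \<open>(e, 1)\<close>, reduced by
      \<open>e^2 = - e - 1\<close>. The factors \<open>e\<close> and \<open>e - 1\<close> of the
      discriminant lead only to 3, so a second bad prime has to come from the cubic factor.\<close>
    define x where "x = 10 + 13 * e"
    have x: "x \<in> ints" unfolding x_def by (intro ints_closed e(1))
    have norm_x: "x * cnj x = 139"
    proof -
      have "x * cnj x = 100 + 130 * (e + cnj e) + 169 * (e * cnj e)"
        by (simp add: x_def algebra_simps)
      then show ?thesis unfolding norm t(1) using 4 by simp
    qed
    have x0: "x \<noteq> 0" using norm_x by auto
    have "inverse x \<notin> ints"
      using unit_norm[OF x _ x0] norm_x by auto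
    then obtain p where p: "p \<in> nonzero_primes K" "x \<in> p"
      using exists_prime_containing[OF x x0] by blast
    note prime = nonzero_primesD(1)[OF p(1)] and ideal = nonzero_primesD(2)[OF p(1)]
    have 139: "139 \<in> p"
      using ideal_closed(6)[OF ideal ints_closed(6)[OF x] p(2)] norm_x by simp
    have cubic: "cubic_form e 1 = x"
      using sq unfolding cubic_form_def x_def power_one mult_1_right by Groebner_Basis.algebra
    have c4: "c4_form e 1 = - 16 * e - 112 * e^2"
      using sq unfolding c4_form_def power_one mult_1_right by Groebner_Basis.algebra
    have c4_int: "c4_form e 1 \<in> ints" unfolding c4 by (intro ints_closed e(1))
    have "\<not> good_reduction K p E"
    proof (rule not_good_reduction[OF p(1) c4_int _ _ e(5)[unfolded j_parameter_def]])
      have "discr_form e 1 = e^7 * (e - 1)^7 * x" by (simp add: discr_form_def cubic)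
      then show "discr_form e 1 \<in> p"
        using ideal_closed(5)[OF ideal ints_closed(3)[OF ints_closed(5)[OF e(1)] ints_closed(5)[OF e1]] p(2)]
        by simp
      show "c4_form e 1 \<notin> p"
      proof
        assume *: "c4_form e 1 \<in> p"
        have "c4_form e 1 * cnj (c4_form e 1) = 256 * (e * cnj e) + 1792 * (e * cnj e) * (e + cnj e) + 12544 * (e * cnj e)^2"
          unfolding c4 by (simp add: algebra_simps power2_eq_square)
        also have "\<dots> = 11008" unfolding norm t(1) using 4 by simp
        finally have "c4_form e 1 * cnj (c4_form e 1) = 11008" .
        then have "11008 \<in> p" using ideal_closed(6)[OF ideal ints_closed(6)[OF c4_int] *] by simp
        \<comment> \<open>\<open>11008 = 2^8 * 43\<close> is coprime to the prime 139; the
          coefficients come from the Euclidean algorithm.\<close>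
        moreover have "2851 * 139 + - 36 * 11008 = (1::complex)" "2851 \<in> ints" "- 36 \<in> ints"
          by (simp, (intro ints_closed)+)
        ultimately show False
          using bezout_not_in_prime[OF prime 139] by blast
      qed
    qed
    then have "3 \<in> p" using q(2)[OF p(1)] 3 by simp
    moreover have "1 * 139 + - 46 * 3 = (1::complex)" "- 46 \<in> ints"
      by (simp, intro ints_closed)
    ultimately have False
      using bezout_not_in_prime[OF prime 139 _ ints_closed(8)] by blast
    then show ?thesis ..
  qed
  then show ?thesis using sq by simp
qed

lemma parameter_sixth_root:
  assumes q: "2 \<notin> q"
      "\<And>p. p \<in> nonzero_primes K \<Longrightarrow> \<not> good_reduction K p E \<Longrightarrow> p = q"
    and d: "d \<in> K" "d \<noteq> 0" "d \<noteq> 1" "j_parameter E d 1"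
  shows "d^2 - d + 1 = 0"
proof -
  obtain a b x y where ab: "a \<in> ints" "b \<in> ints" "x \<in> ints" "y \<in> ints" "b \<noteq> 0" "d = a / b"
    "x * a + y * b = 1"
    by (rule lowest_terms[OF d(1)])
  have a0: "a \<noteq> 0" "a - b \<noteq> 0" using d(2,3) ab(5,6) by auto
  have j0: "j_parameter E a b"
    using j_parameter_scale[OF ab(5), of E d 1] d(4) ab(5,6) by simp
  have j1: "j_parameter E (a - b) a" by (rule j_parameter_cyclic[OF j0])
  have j2: "j_parameter E (- b) (a - b)" using j_parameter_cyclic[OF j1] by simp
  have one: False if p: "p \<in> nonzero_primes K" "a \<in> p" "b \<in> p" for p
    by (rule bezout_not_in_prime[OF nonzero_primesD(1)[OF p(1)] p(2,3) ab(3,4,7)])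
  have two: False if p: "p \<in> nonzero_primes K" "a - b \<in> p" "a \<in> p" for p
  proof -
    have "a - (a - b) \<in> p" by (rule ideal_closed(4)[OF nonzero_primesD(2)[OF p(1)] p(3,2)])
    then show False using one p by simp
  qed
  have three: False if p: "p \<in> nonzero_primes K" "a - b \<in> p" "b \<in> p" for p
  proof -
    have "(a - b) + b \<in> p" by (rule ideal_closed(3)[OF nonzero_primesD(2)[OF p(1)] p(2,3)])
    then show False using one p by simp
  qed
  have dab: "a - b \<in> ints" by (rule ints_closed(2)[OF ab(1,2)])
  have a_q: "a \<in> q \<and> q \<in> nonzero_primes K" if inv: "inverse a \<notin> ints"
  proof -
    obtain p where p: "p \<in> nonzero_primes K" "a \<in> p"
      by (rule exists_prime_containing[OF ab(1) a0(1) inv])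
    then have "b \<notin> p" using one by blast
    then show ?thesis
      using not_good_reduction_parameter[OF p(1) j0 p(2) ab(2)] q(2)[OF p(1)] p by blast
  qed
  have dab_q: "a - b \<in> q \<and> q \<in> nonzero_primes K" if inv: "inverse (a - b) \<notin> ints"
  proof -
    obtain p where p: "p \<in> nonzero_primes K" "a - b \<in> p"
      by (rule exists_prime_containing[OF dab a0(2) inv])
    then have "a \<notin> p" using two by blast
    then show ?thesis
      using not_good_reduction_parameter[OF p(1) j1 p(2) ab(1)] q(2)[OF p(1)] p by blast
  qed
  have b_q: "b \<in> q \<and> q \<in> nonzero_primes K" if inv: "inverse b \<notin> ints"
  proof -
    obtain p where p: "p \<in> nonzero_primes K" "b \<in> p"
      by (rule exists_prime_containing[OF ab(2) ab(5) inv])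
    then have "a - b \<notin> p" using three by blast
    moreover have "- b \<in> p"
      using ideal_closed(4)[OF nonzero_primesD(2)[OF p(1)] ideal_closed(2)[OF nonzero_primesD(2)[OF p(1)]] p(2)]
      by simp
    ultimately show ?thesis
      using not_good_reduction_parameter[OF p(1) j2 _ dab] q(2)[OF p(1)] p by blast
  qed
  have unit: "e^2 - e + 1 = 0"
    if uv: "e = u / v" "u \<in> ints" "v \<in> ints" "inverse u \<in> ints" "inverse v \<in> ints" "u \<noteq> 0" "v \<noteq> 0" "u \<noteq> v"
      "j_parameter E u v" for e u v
  proof (rule unit_parameter[OF q])
    show "e \<in> ints" "inverse e \<in> ints"
      unfolding uv(1) divide_inverse inverse_mult_distrib inverse_inverse_eq
      by (intro ints_closed(3) uv(2-5))+
    show "e \<noteq> 0" "e \<noteq> 1" using uv by auto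
    show "j_parameter E e 1" using j_parameter_scale[OF uv(7), of E e 1] uv(1,7,9) by simp
  qed
  consider "inverse a \<in> ints" "inverse b \<in> ints" | "inverse (a - b) \<in> ints" "inverse a \<in> ints"
    | "inverse (a - b) \<in> ints" "inverse b \<in> ints"
    using a_q b_q dab_q one two three by blast
  then show ?thesis
  proof cases
    case 1
    have "a \<noteq> b" using a0(2) by simp
    then show ?thesis using unit[OF ab(6,1,2) 1 a0(1) ab(5) _ j0] by blast
  next
    case 2
    have "a - b \<noteq> a" using ab(5) by simp
    then have *: "((a - b) / a)^2 - (a - b) / a + 1 = 0"
      using unit[OF refl dab ab(1) 2 a0(2,1) _ j1] by blast
    \<comment> \<open>This is \<open>1 - 1 / d\<close>, the parameter after one rotation. The
      equation carries back to \<open>d\<close> because its roots are fixed by the rotation.\<close>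
    define f where "f = (a - b) / a"
    have "f * d = d - 1" unfolding f_def ab(6) using a0 ab(5) by (simp add: field_simps)
    moreover have "f^2 - f + 1 = 0" using * by (simp add: f_def)
    ultimately have "d^2 - d + 1 = 0" by Groebner_Basis.algebra
    then show ?thesis .
  next
    case 3
    have b: "- b \<in> ints" "inverse (- b) \<in> ints" "- b \<noteq> 0" "- b \<noteq> a - b"
      using ints_closed(4)[OF ab(2)] ints_closed(4)[OF 3(2)] ab(5) a0 by auto
    have *: "(- b / (a - b))^2 - (- b / (a - b)) + 1 = 0"
      by (rule unit[OF refl b(1) dab b(2) 3(1) b(3) a0(2) b(4) j2])
    \<comment> \<open>This is \<open>1 / (1 - d)\<close>, the parameter after two rotations.\<close>
    define f where "f = - b / (a - b)"
    have "f * (1 - d) = 1" unfolding f_def ab(6) using a0 ab(5) by (simp add: field_simps)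
    moreover have "f^2 - f + 1 = 0" using * by (simp add: f_def)
    ultimately have "d^2 - d + 1 = 0" by Groebner_Basis.algebra
    then show ?thesis .
  qed
qed

end

section \<open>Identification of the field and of the curve\<close>

lemma (in imaginary_quadratic) eq_generate_field_sqrt_minus_3:
  assumes "w \<in> K" "w^2 = - 3"
  shows "K = generate_field complex_field {csqrt (- 3)}"
proof
  let ?F = "generate_field complex_field {csqrt (- 3)}"
  have field: "field complex_field" by (rule field_from_type_algebra)
  have "w^2 = (csqrt (- 3))^2" unfolding power2_csqrt by (rule assms(2))
  then have w: "w = csqrt (- 3) \<or> w = - csqrt (- 3)" by (metis power2_eq_iff)
  then have "csqrt (- 3) \<in> K" using assms(1) closed(5)[OF assms(1)] minus_minus by metis
  then show "?F \<subseteq> K"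
    using field.generate_field_min_subfield1[OF field _ subfield] by simp
  interpret F: complex_subfield ?F
    using field.generate_field_is_subfield[OF field] by (simp add: complex_subfield_def)
  have "csqrt (- 3) \<in> ?F" by (rule generate_field.incl) simp
  then have wF: "w \<in> ?F" using F.closed(5) by (metis w)
  have "w \<notin> \<rat>"
  proof
    assume "w \<in> \<rat>"
    then obtain r where "w = complex_of_real r" using Rats_real by blast
    then have "complex_of_real (r^2) = complex_of_real (- 3)" using assms(2) by simp
    then have "r^2 = - 3" by (simp only: of_real_eq_iff)
    then show False using zero_le_power2[of r] by linarith
  qed
  show "K \<subseteq> ?F"
  proof
    fix x assume "x \<in> K"
    then obtain a b where ab: "a \<in> \<rat>" "b \<in> \<rat>" "x = a + b * w"
      using spanned_by_one_and[OF assms(1) \<open>w \<notin> \<rat>\<close>] by blast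
    show "x \<in> ?F"
      unfolding ab(3) by (intro F.closed(3,4) F.Rats_closed ab(1,2) wF)
  qed
qed

text \<open>Here \<open>d^3 = - 1\<close>, so \<open>c = - 1\<close> and \<open>b = - d\<close>, and
  the coefficient of x y is 2. The shift \<open>s = - 1\<close> removes that term;
  \<open>r = - 1\<close> and \<open>t = 1\<close> then adjust the other coefficients.\<close>

lemma tate_sixth_root_change_coords:
  fixes d :: "'a::field"
  assumes "d^2 - d + 1 = 0"
  shows "change_coords 1 (- 1) (- 1) 1 (tate (d^3 - d^2) (d^2 - d)) (Weierstrass 0 (d - 2) d (1 - d) 0)"
  unfolding tate_def change_coords_Weierstrass power_one mult_1
  using assms by (intro conjI) (simp, Groebner_Basis.algebra+)

theorem theorem4p8:
  fixes K :: "complex set" and E :: "complex weierstrass"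
  assumes "imaginary_quadratic_field K"
    and "class_number K = 1"
    and "elliptic_curve K E"
    and "prime_power_ideal K (conductor K E)"
    and "odd_ideal K (conductor K E)"
    and "\<exists>P. has_order (point_group K E) P 7"
  shows "K = generate_field complex_field {csqrt (-3)} \<and>
    (\<exists>w. w^2 = -3 \<and>
      (let a = (1 + w) / 2 in isomorphic_over K E (Weierstrass 0 (a - 2) a (1 - a) 0)))"
proof -
  interpret class_number_one K
    using assms(1,2) by unfold_locales
  obtain P where P: "has_order (point_group K E) P 7" using assms(6) by blast
  have over_K: "defined_over K E" using assms(3) by (simp add: elliptic_curve_def)
  obtain b c where bc: "b \<in> K" "c \<in> K" "b \<noteq> 0" "isomorphic_over K E (tate b c)"
    and mult: "\<And>m. multiple E P m = AtInfinity \<longleftrightarrow> multiple (tate b c) (Affine 0 0) m = AtInfinity"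
    by (rule tate_normal_form[OF over_K P]) simp_all
  have order: "multiple E P 7 = AtInfinity"
    "\<And>m. 0 < m \<Longrightarrow> m < 7 \<Longrightarrow> multiple E P m \<noteq> AtInfinity"
    using P by (simp_all add: has_order_def point_group_pow)
  obtain d where d: "d \<noteq> 0" "d \<noteq> 1" "c = d^2 - d" "b = d^3 - d^2"
    using order_seven_tate_parameters[OF bc(3) order[unfolded mult]] .
  \<comment> \<open>So far \<open>d\<close> is only a complex number; dividing \<open>b\<close> by
    \<open>c\<close> exhibits it as an element of \<open>K\<close>.\<close>
  have "c \<noteq> 0"
  proof
    assume "c = 0"
    then have "d * (d - 1) = 0" unfolding d(3) by (simp add: algebra_simps power2_eq_square)
    then show False using d(1,2) by simp
  qed
  moreover have "b = c * d" unfolding d(3,4) by Groebner_Basis.algebra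
  ultimately have "d = b / c" by simp
  then have "d \<in> K" using bc(1,2) by simp
  obtain u where u: "u \<noteq> 0" "c4 E = u ^ 4 * c4 (tate b c)" "discr E = u ^ 12 * discr (tate b c)"
    by (rule discr_c4_scale[OF bc(4)])
  have "j_parameter E d 1"
    unfolding j_parameter_def u(2,3) d(3,4) c4_discr_tate
    by (simp add: power_mult_distrib flip: power_mult)
  obtain q where "2 \<notin> q" "\<And>p. p \<in> nonzero_primes K \<Longrightarrow> \<not> good_reduction K p E \<Longrightarrow> p = q"
    using unique_bad_prime[OF assms(4,5)] by blast
  then have root: "d^2 - d + 1 = 0"
    by (rule parameter_sixth_root[OF _ _ \<open>d \<in> K\<close> d(1,2) \<open>j_parameter E d 1\<close>])
  \<comment> \<open>Chosen to make \<open>(1 + w) / 2 = d\<close>. Since \<open>d\<close> may be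
    either primitive sixth root of unity, \<open>w\<close> is one of the two square roots of
    -3.\<close>
  define w where "w = 2 * d - 1"
  have w: "w^2 = - 3" using root unfolding w_def by Groebner_Basis.algebra
  have "w \<in> K" using \<open>d \<in> K\<close> by (simp add: w_def)
  have a: "(1 + w) / 2 = d" by (simp add: w_def)
  have "isomorphic_over K (tate b c) (Weierstrass 0 (d - 2) d (1 - d) 0)"
    unfolding isomorphic_over_iff d(3,4)
    using tate_sixth_root_change_coords[OF root] closed(2) closed(5)[OF closed(2)] by blast
  then have "isomorphic_over K E (Weierstrass 0 (d - 2) d (1 - d) 0)"
    by (rule isomorphic_over_trans[OF bc(4)])
  then show ?thesis
    using w eq_generate_field_sqrt_minus_3[OF \<open>w \<in> K\<close> w] unfolding Let_def
    by (intro conjI exI[of _ w]) (simp_all only: a)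
qed

end
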